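(* Let $F$ be an infinite field of characteristic $3$, let $A=F[x_1,\dots,x_m]/(x_1^2,\dots,x_m^2)$ with homogeneous components $A_j$, let $U\subseteq A_1$ be a subspace with $\dim U=n\ge 1$, and let $k\ge 0$ be an integer. (A) If $\mathrm{ms}_i(U)\ge 4i-2+2k$ for all $1\le i\le n$, then $\{f\in A_k: fw=0\ \forall w\in U^{2n}\}=A_k\cap \mathrm{Im}(U)$. (B) If $\mathrm{ms}_i(U)\ge 4i-3+2k$ for all $1\le i\le n$, then $\{f\in A_{2n-2+k}: fu=0\ \forall u\in U\}=A_{2n-2+k}\cap \mathrm{Im}(U^{2n})$.
   Context: $A$ is graded by degree; elements of $A_1$ are linear forms. For a linear form $u=\sum_i c_ix_i$, $\mathrm{supp}(u)=\{x_i:c_i\ne0\}$; for a subspace $V\subseteq A_1$, $\mathrm{supp}(V)=\bigcup_{v\in V}\mathrm{supp}(v)$, and for $1\le i\le \dim U$, $\mathrm{ms}_i(U)=\min\{|\mathrm{supp}(V)|: V\subseteq U\text{ a subspace}, \dim V=i\}$. For subspaces $W\subseteq A_a$, $W'\subseteq A_b$, $WW'$ is the subspace of $A_{a+b}$ spanned by products $ww'$; $U^{2n}$ is the subspace of $A_{2n}$ spanned by all products of $2n$ elements of $U$. For a subspace $W$ of $A$, $\mathrm{Im}(W)$ denotes the ideal of $A$ generated by $W$. *)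

theory Defs
  imports Complex_Main "HOL-Library.Function_Algebras"
begin

text \<open>Model of A = F[x_0,...,x_(m-1)]/(x_0^2,...,x_(m-1)^2): an element is a coefficient
function on squarefree monomials, a monomial being a set S of variable indices
(S = {i1,...,ir} stands for x_i1 ... x_ir). Elements of A are those functions supported
on subsets of {..<m}. Addition is pointwise (Function_Algebras); scalar multiplication is
the scaling below; multiplication is the product induced by x_i^2 = 0.\<close>

definition sc :: "'a::field \<Rightarrow> (nat set \<Rightarrow> 'a) \<Rightarrow> (nat set \<Rightarrow> 'a)" where
  "sc c f = (\<lambda>S. c * f S)"

global_interpretation FS: vector_space "sc :: 'a::field \<Rightarrow> (nat set \<Rightarrow> 'a) \<Rightarrow> _"
  by unfold_locales (auto simp: sc_def fun_eq_iff algebra_simps)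

definition Aalg :: "nat \<Rightarrow> (nat set \<Rightarrow> 'a::field) set" where
  "Aalg m = {f. \<forall>S. f S \<noteq> 0 \<longrightarrow> S \<subseteq> {..<m}}"

definition Acomp :: "nat \<Rightarrow> nat \<Rightarrow> (nat set \<Rightarrow> 'a::field) set" where
  "Acomp m j = {f. \<forall>S. f S \<noteq> 0 \<longrightarrow> S \<subseteq> {..<m} \<and> card S = j}"

text \<open>Multiplication: x_S * x_T = x_(S \<union> T) if S, T disjoint, and 0 otherwise.\<close>
definition amul :: "(nat set \<Rightarrow> 'a::field) \<Rightarrow> (nat set \<Rightarrow> 'a) \<Rightarrow> (nat set \<Rightarrow> 'a)" where
  "amul f g = (\<lambda>S. \<Sum>T\<in>Pow S. f T * g (S - T))"

definition aone :: "nat set \<Rightarrow> 'a::field" where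
  "aone S = (if S = {} then 1 else 0)"

definition supp_lf :: "(nat set \<Rightarrow> 'a::field) \<Rightarrow> nat set" where
  "supp_lf u = {i. u {i} \<noteq> 0}"

definition supp_sp :: "(nat set \<Rightarrow> 'a::field) set \<Rightarrow> nat set" where
  "supp_sp V = (\<Union>v\<in>V. supp_lf v)"

definition ms :: "nat \<Rightarrow> (nat set \<Rightarrow> 'a::field) set \<Rightarrow> nat" where
  "ms i U = Min {card (supp_sp V) | V. FS.subspace V \<and> V \<subseteq> U \<and> FS.dim V = i}"

definition prodsp :: "(nat set \<Rightarrow> 'a::field) set \<Rightarrow> (nat set \<Rightarrow> 'a) set \<Rightarrow> (nat set \<Rightarrow> 'a) set" where
  "prodsp W W' = FS.span {amul w w' | w w'. w \<in> W \<and> w' \<in> W'}"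

definition powsp :: "(nat set \<Rightarrow> 'a::field) set \<Rightarrow> nat \<Rightarrow> (nat set \<Rightarrow> 'a) set" where
  "powsp U r = FS.span {foldr amul us aone | us. length us = r \<and> set us \<subseteq> U}"

text \<open>Im(W): the ideal of A generated by W (A commutative with 1, so it is the span of a*w).\<close>
definition ideal_gen :: "nat \<Rightarrow> (nat set \<Rightarrow> 'a::field) set \<Rightarrow> (nat set \<Rightarrow> 'a) set" where
  "ideal_gen m W = FS.span {amul a w | a w. a \<in> Aalg m \<and> w \<in> W}"

end

theory Submission
  imports Defs "HOL-Computational_Algebra.Polynomial"
begin

text \<open>Let \<open>w = u\<^sub>1\<^sup>2 \<cdots> u\<^sub>n\<^sup>2\<close> for a basis of \<open>U\<close>. In characteristic 3 linear forms have cube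
  zero, so \<open>U\<^sup>2\<^sup>n\<close> is spanned by \<open>w\<close>, and the claims are (A) \<open>Ann(w) = (U)\<close> in degree \<open>k\<close> and
  (B) \<open>Ann(U) = (w)\<close> in degree \<open>2n - 2 + k\<close>. Both are proved together by induction on the number
  of variables plus \<open>n\<close>.

  For (A), choose a variable \<open>x\<close> in the support of \<open>U\<close>, a basis vector \<open>u = v + x\<close>, and let \<open>V\<close> be the
  forms of \<open>U\<close> without \<open>x\<close>. Writing \<open>f = g + xh\<close> without \<open>x\<close> in \<open>g\<close> and \<open>h\<close>, the equation \<open>f w = 0\<close>
  becomes \<open>y v w\<^sub>V = 0\<close> for \<open>y = g - hv\<close>. Now (B) for \<open>V + \<langle>v\<rangle>\<close> gives \<open>y w\<^sub>V = b v\<^sup>2 w\<^sub>V\<close>, and (A)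
  for \<open>V\<close> gives \<open>y - b v\<^sup>2 \<in> (V)\<close>; deleting \<open>x\<close> costs at most one element of each support.

  For (B) with \<open>n \<ge> 2\<close>, choose a hyperplane \<open>H\<close> of \<open>U\<close> that contains none of the nonzero coordinate
  subspaces of \<open>U\<close>; then \<open>ms\<^sub>i(H) \<ge> ms\<^sub>i\<^sub>+\<^sub>1(U)\<close>, a gain of 4, so that (B) for \<open>H\<close> and \<open>k + 2\<close> gives
  \<open>f = c w\<^sub>H\<close>. With \<open>q = z + x \<in> H\<close>, \<open>L = {v \<in> H. x \<notin> supp(v)}\<close>, a form \<open>u \<in> U - H\<close> without \<open>x\<close>,
  and \<open>y\<close> obtained from \<open>c\<close> as above, \<open>f u = 0\<close> becomes \<open>y z u w\<^sub>L = 0\<close>. Then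
  (B) for \<open>L + \<langle>z\<rangle>\<close> gives \<open>y u w\<^sub>L = b z\<^sup>2 w\<^sub>L\<close>, (A) for \<open>L + \<langle>u, z\<rangle>\<close> and \<open>k - 1\<close> gives
  \<open>b \<in> b\<^sub>1 u + (z) + (L)\<close>, and (B) for \<open>L + \<langle>u\<rangle>\<close> applied to \<open>(y - b\<^sub>1 z\<^sup>2) w\<^sub>L\<close> concludes.\<close>

section \<open>The squarefree algebra as a commutative ring\<close>

typedef (overloaded) 'a sqf = "{f :: nat set \<Rightarrow> 'a::field. \<forall>S. infinite S \<longrightarrow> f S = 0}"
  morphisms coef Abs_sqf
  by (rule exI[of _ "\<lambda>_. 0"]) simp

definition sqf_of :: "(nat set \<Rightarrow> 'a::field) \<Rightarrow> 'a sqf" where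
  "sqf_of f = Abs_sqf (\<lambda>S. if finite S then f S else 0)"

lemma coef_sqf_of: "coef (sqf_of f) S = (if finite S then f S else 0)"
  by (simp add: sqf_of_def Abs_sqf_inverse)

lemma coef_infinite: "infinite S \<Longrightarrow> coef f S = 0"
  using coef[of f] by simp

lemma sqf_eqI: "(\<And>S. finite S \<Longrightarrow> coef f S = coef g S) \<Longrightarrow> f = g"
  by (metis coef_infinite coef_inject ext)

lemma amul_infinite: "infinite S \<Longrightarrow> amul f g S = 0"
  by (simp add: amul_def)

lemma amul_commute: "amul f g = amul g f"
proof
  fix S
  show "amul f g S = amul g f S"
    unfolding amul_def
    by (rule sum.reindex_bij_witness[where i="\<lambda>T. S - T" and j="\<lambda>T. S - T"])
      (auto simp: double_diff mult.commute)
qed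

lemma amul_assoc: "amul (amul f g) h = amul f (amul g h)"
proof
  fix S :: "nat set"
  show "amul (amul f g) h S = amul f (amul g h) S"
  proof (cases "finite S")
    case True
    have "amul (amul f g) h S = (\<Sum>T\<in>Pow S. \<Sum>R\<in>Pow T. f R * g (T - R) * h (S - T))"
      by (simp add: amul_def sum_distrib_right)
    also have "\<dots> = (\<Sum>(T, R)\<in>(SIGMA T:Pow S. Pow T). f R * g (T - R) * h (S - T))"
      using True by (subst sum.Sigma) (auto intro: finite_subset)
    \<comment> \<open>Both sides run over ordered partitions of S into three parts; the middle part
      is Q = T - R.\<close>
    also have "\<dots> = (\<Sum>(R, Q)\<in>(SIGMA R:Pow S. Pow (S - R)). f R * (g Q * h (S - R - Q)))"
      by (rule sum.reindex_bij_witness[where i="\<lambda>(R, Q). (R \<union> Q, R)" and j="\<lambda>(T, R). (R, T - R)"])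
        (auto simp: mult.assoc Un_Diff intro!: arg_cong[where f=h] arg_cong[where f=g])
    also have "\<dots> = (\<Sum>R\<in>Pow S. \<Sum>Q\<in>Pow (S - R). f R * (g Q * h (S - R - Q)))"
      using True by (subst sum.Sigma) (auto intro: finite_subset)
    also have "\<dots> = amul f (amul g h) S"
      by (simp add: amul_def sum_distrib_left)
    finally show ?thesis .
  qed (simp add: amul_infinite)
qed

lemma amul_add: "amul (f + g) h = amul f h + amul g h"
  by (auto simp: amul_def fun_eq_iff distrib_right sum.distrib)

instantiation sqf :: (field) comm_ring_1
begin

definition zero_sqf where "0 = sqf_of (\<lambda>_. 0)"
definition one_sqf where "1 = sqf_of aone"
definition plus_sqf where "f + g = sqf_of (\<lambda>S. coef f S + coef g S)"
definition uminus_sqf where "- f = sqf_of (\<lambda>S. - coef f S)"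
definition minus_sqf where "f - g = sqf_of (\<lambda>S. coef f S - coef g S)"
definition times_sqf where "f * g = sqf_of (amul (coef f) (coef g))"

lemma coef_ring [simp]:
  "coef 0 S = 0" "coef (f + g) S = coef f S + coef g S" "coef (- f) S = - coef f S"
  "coef (f - g) S = coef f S - coef g S"
  by (auto simp: zero_sqf_def plus_sqf_def uminus_sqf_def minus_sqf_def coef_sqf_of coef_infinite)

lemma coef_mult: "coef (f * g) = amul (coef f) (coef g)"
  by (auto simp: times_sqf_def coef_sqf_of amul_infinite)

lemma coef_one: "coef 1 = aone"
  by (auto simp: one_sqf_def coef_sqf_of aone_def)

instance
proof
  fix f g h :: "'a sqf"
  show "f * g * h = f * (g * h)"
    by (rule sqf_eqI) (simp add: coef_mult amul_assoc)
  show "f * g = g * f"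
    by (rule sqf_eqI) (simp add: coef_mult amul_commute)
  show "1 * f = f"
    by (rule sqf_eqI) (simp add: coef_mult coef_one amul_def aone_def if_distrib[of "\<lambda>c. c * _"]
        sum.delta cong: if_cong)
  have "coef (f + g) = coef f + coef g" by auto
  then show "(f + g) * h = f * h + g * h"
    by (intro sqf_eqI) (simp add: coef_mult amul_add)
  have "coef (0::'a sqf) {} \<noteq> coef 1 {}" by (simp add: coef_one aone_def)
  then show "(0::'a sqf) \<noteq> 1" by metis
qed (auto intro!: sqf_eqI)

end

definition cst :: "'a::field \<Rightarrow> 'a sqf" where
  "cst c = sqf_of (\<lambda>S. if S = {} then c else 0)"

definition var :: "nat \<Rightarrow> 'a::field sqf" where
  "var x = sqf_of (\<lambda>S. if S = {x} then 1 else 0)"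

lemma coef_cst: "coef (cst c) S = (if S = {} then c else 0)"
  by (simp add: cst_def coef_sqf_of)

lemma coef_var: "coef (var x) S = (if S = {x} then 1 else 0)"
  by (simp add: var_def coef_sqf_of)

lemma coef_cst_mult [simp]: "coef (cst c * f) S = c * coef f S"
proof (cases "finite S")
  case True
  then show ?thesis
    by (simp add: coef_mult amul_def coef_cst if_distrib[of "\<lambda>c. c * _"] sum.delta cong: if_cong)
qed (simp add: coef_infinite)

lemma coef_var_mult: "coef (var x * f) S = (if x \<in> S then coef f (S - {x}) else 0)"
proof (cases "finite S")
  case True
  then show ?thesis
    by (simp add: coef_mult amul_def coef_var if_distrib[of "\<lambda>c. c * _"] sum.delta cong: if_cong)
qed (simp add: coef_infinite)

lemma cst_simps: "cst (a + b) = cst a + cst b" "cst (a * b) = cst a * cst b" "cst (- a) = - cst a"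
  "cst (a - b) = cst a - cst b" "cst 0 = 0" "cst 1 = 1"
  by (auto intro!: sqf_eqI simp: coef_cst coef_one aone_def)

lemma var_square: "var x * var x = 0"
  by (rule sqf_eqI) (auto simp: coef_var_mult coef_var)

lemma var_nonzero: "var x \<noteq> 0"
  by (metis coef_ring(1) coef_var one_neq_zero)

lemma three_eq_zero: "CHAR('a::field) = 3 \<Longrightarrow> (3 :: 'a sqf) = 0"
proof -
  assume "CHAR('a) = 3"
  then have "(3 :: 'a) = 0" by (metis of_nat_CHAR of_nat_numeral)
  then have "cst (1 + 1 + 1 :: 'a) = 0" by (simp add: cst_simps)
  then show ?thesis unfolding cst_simps by simp
qed


section \<open>Homogeneous elements\<close>

text \<open>The degree is an integer, so that components of negative degree are zero.\<close>

definition homog :: "nat set \<Rightarrow> int \<Rightarrow> 'a::field sqf set" where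
  "homog X d = {f. \<forall>S. coef f S \<noteq> 0 \<longrightarrow> S \<subseteq> X \<and> int (card S) = d}"

lemma homogD: "f \<in> homog X d \<Longrightarrow> coef f S \<noteq> 0 \<Longrightarrow> S \<subseteq> X \<and> int (card S) = d"
  by (auto simp: homog_def)

lemma homog_zero [simp]: "0 \<in> homog X d"
  by (simp add: homog_def)

lemma homog_neg: "f \<in> homog X d \<Longrightarrow> d < 0 \<Longrightarrow> f = 0"
  by (rule sqf_eqI) (use homogD in fastforce)

lemma homog_mono: "f \<in> homog X d \<Longrightarrow> X \<subseteq> Y \<Longrightarrow> f \<in> homog Y d"
  unfolding homog_def by blast

lemma homog_add: "f \<in> homog X d \<Longrightarrow> g \<in> homog X d \<Longrightarrow> f + g \<in> homog X d"
  unfolding homog_def by (simp, metis add.right_neutral)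

lemma homog_minus: "f \<in> homog X d \<Longrightarrow> - f \<in> homog X d"
  by (auto simp: homog_def)

lemma homog_diff: "f \<in> homog X d \<Longrightarrow> g \<in> homog X d \<Longrightarrow> f - g \<in> homog X d"
  using homog_add[OF _ homog_minus] by fastforce

lemma homog_cst_mult: "f \<in> homog X d \<Longrightarrow> cst c * f \<in> homog X d"
  by (auto simp: homog_def)

lemma homog_cst: "cst c \<in> homog X 0"
  by (auto simp: homog_def coef_cst)

lemma homog_var: "x \<in> X \<Longrightarrow> var x \<in> homog X 1"
  by (auto simp: homog_def coef_var)

lemma homog_mult:
  assumes "f \<in> homog X d" "g \<in> homog X e"
  shows "f * g \<in> homog X (d + e)"
  unfolding homog_def
proof (intro CollectI allI impI)
  fix S assume nz: "coef (f * g) S \<noteq> 0"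
  then have fin: "finite S" by (metis coef_infinite)
  from nz obtain T where T: "T \<subseteq> S" "coef f T \<noteq> 0" "coef g (S - T) \<noteq> 0"
    unfolding coef_mult amul_def by (metis (no_types, lifting) PowD mult_eq_0_iff sum.neutral)
  have "card S = card T + card (S - T)"
    using T(1) fin by (metis card_Diff_subset card_mono le_add_diff_inverse rev_finite_subset)
  then show "S \<subseteq> X \<and> int (card S) = d + e"
    using homogD[OF assms(1) T(2)] homogD[OF assms(2) T(3)] by auto
qed

lemma homog_mult': "f \<in> homog X d \<Longrightarrow> g \<in> homog X e \<Longrightarrow> d + e = k \<Longrightarrow> f * g \<in> homog X k"
  using homog_mult by blast

section \<open>Deleting or splitting off one variable\<close>

definition del :: "nat \<Rightarrow> 'a::field sqf \<Rightarrow> 'a sqf" where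
  "del x f = sqf_of (\<lambda>S. if x \<in> S then 0 else coef f S)"

lemma coef_del: "coef (del x f) S = (if x \<in> S then 0 else coef f S)"
  by (simp add: del_def coef_sqf_of coef_infinite)

lemma del_simps: "del x 0 = 0" "del x (f + g) = del x f + del x g" "del x (cst c * f) = cst c * del x f"
  by (auto intro!: sqf_eqI simp: coef_del)

lemma del_homog: "f \<in> homog X d \<Longrightarrow> del x f \<in> homog (X - {x}) d"
  by (auto simp: homog_def coef_del)

lemma del_linear:
  assumes "f \<in> homog X 1"
  shows "f = del x f + cst (coef f {x}) * var x"
proof (rule sqf_eqI)
  fix S :: "nat set" assume "finite S"
  then show "coef f S = coef (del x f + cst (coef f {x}) * var x) S"
    using homogD[OF assms, of S]
    by (auto simp: coef_del coef_var card_1_singleton_iff)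
qed

text \<open>Squarefreeness makes every element of the form g + x h with g and h free of x; h
  collects the coefficients at sets containing x, with x removed.\<close>

lemma homog_split:
  assumes "f \<in> homog X d"
  obtains g h where "g \<in> homog (X - {x}) d" "h \<in> homog (X - {x}) (d - 1)" "f = g + var x * h"
proof
  let ?h = "sqf_of (\<lambda>S. if x \<in> S then 0 else coef f (insert x S))"
  have ch: "coef ?h S = (if x \<in> S then 0 else coef f (insert x S))" for S
    by (simp add: coef_sqf_of coef_infinite)
  show "del x f \<in> homog (X - {x}) d" using assms by (rule del_homog)
  show "?h \<in> homog (X - {x}) (d - 1)"
    unfolding homog_def
  proof (intro CollectI allI impI)
    fix S assume nz: "coef ?h S \<noteq> 0"
    then have "finite S" by (metis coef_infinite)
    moreover from nz have "x \<notin> S" "coef f (insert x S) \<noteq> 0" by (auto simp: ch split: if_splits)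
    ultimately show "S \<subseteq> X - {x} \<and> int (card S) = d - 1"
      using homogD[OF assms, of "insert x S"] by auto
  qed
  show "f = del x f + var x * ?h"
    by (rule sqf_eqI) (auto simp: coef_del coef_var_mult ch insert_absorb)
qed

text \<open>At a set containing x the first summand has coefficient 0, so the equation there reads
  off a coefficient of \<open>h\<close>. One equation thus becomes two with one variable
  fewer.\<close>

lemma split_unique:
  assumes "g + var x * h = 0" "g \<in> homog X d" "h \<in> homog Y e" "x \<notin> X" "x \<notin> Y"
  shows "g = 0" "h = 0"
proof -
  have c: "coef g S + coef (var x * h) S = 0" for S
    using arg_cong[OF assms(1), of "\<lambda>f. coef f S"] by simp
  show "h = 0"
  proof (rule sqf_eqI)
    fix S :: "nat set"
    show "coef h S = coef 0 S"
    proof (cases "x \<in> S")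
      case True
      then show ?thesis using homogD[OF assms(3), of S] assms(5) by auto
    next
      case False
      have "coef g (insert x S) = 0"
        using homogD[OF assms(2), of "insert x S"] assms(4) by blast
      then show ?thesis
        using c[of "insert x S"] False by (simp add: coef_var_mult)
    qed
  qed
  with assms(1) show "g = 0" by simp
qed

text \<open>Expanding (g + x h)^3 leaves g^3, a multiple of 3 and a multiple of x^2, so induction on
  the variables applies.\<close>

lemma linear_cube:
  fixes u :: "'a::field sqf"
  assumes "CHAR('a) = 3" "finite X" "u \<in> homog X 1"
  shows "u ^ 3 = 0"
  using assms(2,3)
proof (induction X arbitrary: u)
  case empty
  have "u = 0" by (rule sqf_eqI) (use homogD[OF empty] in fastforce)
  then show ?case by simp
next
  case (insert x X)
  obtain g h where gh: "g \<in> homog (insert x X - {x}) 1" "u = g + var x * h"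
    using homog_split[OF insert.prems] by metis
  have "g ^ 3 = 0" using insert gh by simp
  moreover have "u ^ 3 = g ^ 3 + 3 * (g ^ 2 * var x * h) + (var x * var x) * (3 * g * h ^ 2 + var x * h ^ 3)"
    unfolding gh(2) by (simp add: algebra_simps power2_eq_square power3_eq_cube)
  ultimately show ?case using three_eq_zero[OF assms(1)] by (simp add: var_square)
qed

section \<open>Flags of linear forms\<close>

text \<open>Subspaces are handled inside the ring, with scalars embedded by \<open>cst\<close>; the
  last section translates to \<open>FS.subspace\<close>.\<close>

definition lin_closed :: "'a::field sqf set \<Rightarrow> bool" where
  "lin_closed V \<longleftrightarrow> 0 \<in> V \<and> (\<forall>u\<in>V. \<forall>v\<in>V. u + v \<in> V) \<and> (\<forall>c. \<forall>v\<in>V. cst c * v \<in> V)"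

definition ext :: "'a::field sqf set \<Rightarrow> 'a sqf \<Rightarrow> 'a sqf set" where
  "ext V u = {v + cst c * u | v c. v \<in> V}"

text \<open>\<open>flag V n w\<close>: the subspace \<open>V\<close> has a basis \<open>u\<^sub>1, \<dots>, u\<^sub>n\<close> with
  \<open>w = u\<^sub>1\<^sup>2 \<cdots> u\<^sub>n\<^sup>2\<close>.\<close>

inductive flag :: "'a::field sqf set \<Rightarrow> nat \<Rightarrow> 'a sqf \<Rightarrow> bool" where
  flag_0: "flag {0} 0 1"
| flag_Suc: "flag V n w \<Longrightarrow> u \<notin> V \<Longrightarrow> flag (ext V u) (Suc n) (u ^ 2 * w)"

lemma extI: "v \<in> V \<Longrightarrow> v + cst c * u \<in> ext V u"
  by (auto simp: ext_def)

lemma lin_closedD: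
  assumes "lin_closed V"
  shows "0 \<in> V" "u \<in> V \<Longrightarrow> v \<in> V \<Longrightarrow> u + v \<in> V" "v \<in> V \<Longrightarrow> cst c * v \<in> V"
    "u \<in> V \<Longrightarrow> v \<in> V \<Longrightarrow> u - v \<in> V" "v \<in> V \<Longrightarrow> - v \<in> V"
proof -
  show *: "0 \<in> V" "\<And>u v. u \<in> V \<Longrightarrow> v \<in> V \<Longrightarrow> u + v \<in> V" "\<And>c v. v \<in> V \<Longrightarrow> cst c * v \<in> V"
    using assms by (auto simp: lin_closed_def)
  have **: "- v \<in> V" if "v \<in> V" for v
    using *(3)[OF that, of "- 1"] by (simp add: cst_simps)
  then show "v \<in> V \<Longrightarrow> - v \<in> V" .
  show "u \<in> V \<Longrightarrow> v \<in> V \<Longrightarrow> u - v \<in> V"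
    using *(2) ** by fastforce
qed

lemma lin_closed_ext:
  assumes "lin_closed V" shows "lin_closed (ext V u)"
  unfolding lin_closed_def
proof (intro conjI ballI allI)
  note V = lin_closedD[OF assms]
  show "0 \<in> ext V u" using extI[OF V(1), of 0 u] by (simp add: cst_simps)
  fix p c assume "p \<in> ext V u"
  then obtain v a where p: "p = v + cst a * u" "v \<in> V" by (auto simp: ext_def)
  then show "cst c * p \<in> ext V u"
    using extI[OF V(3)[OF p(2)], of c "c * a" u] by (simp add: cst_simps algebra_simps)
  fix q assume "q \<in> ext V u"
  then obtain v' b where q: "q = v' + cst b * u" "v' \<in> V" by (auto simp: ext_def)
  show "p + q \<in> ext V u"
    using extI[OF V(2)[OF p(2) q(2)], of "a + b" u] by (simp add: p q cst_simps algebra_simps)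
qed

lemma subset_ext: "V \<subseteq> ext V u"
proof
  fix v assume "v \<in> V"
  then show "v \<in> ext V u" using extI[of v V 0 u] by (simp add: cst_simps)
qed

lemma in_ext: "lin_closed V \<Longrightarrow> u \<in> ext V u"
  using extI[OF lin_closedD(1), of V 1 u] by (simp add: cst_simps)

lemma ext_subset: "lin_closed U \<Longrightarrow> V \<subseteq> U \<Longrightarrow> u \<in> U \<Longrightarrow> ext V u \<subseteq> U"
  by (auto simp: ext_def intro!: lin_closedD)

lemma ext_commute: "ext (ext V u) u' = ext (ext V u') u"
proof -
  have "ext (ext V u) u' \<subseteq> ext (ext V u') u" for u u' :: "'a sqf"
  proof
    fix p assume "p \<in> ext (ext V u) u'"
    then obtain v a b where "p = v + cst a * u + cst b * u'" "v \<in> V" by (auto simp: ext_def)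
    then show "p \<in> ext (ext V u') u"
      using extI[OF extI[of v V b u'], of a u] by (simp add: algebra_simps)
  qed
  then show ?thesis by blast
qed

lemma ext_shift:
  assumes "lin_closed V" "v \<in> V"
  shows "ext V (u - v) = ext V u"
proof
  show "ext V (u - v) \<subseteq> ext V u"
    using extI[OF lin_closedD(5)[OF assms], of 1 u]
    by (intro ext_subset lin_closed_ext assms subset_ext) (simp add: cst_simps)
  show "ext V u \<subseteq> ext V (u - v)"
    using extI[OF assms(2), of 1 "u - v"]
    by (intro ext_subset lin_closed_ext assms subset_ext) (simp add: cst_simps)
qed

lemma flag_lin_closed: "flag V n w \<Longrightarrow> lin_closed V"
  by (induction rule: flag.induct) (auto simp: lin_closed_ext, auto simp: lin_closed_def)

lemma flag_0_iff: "flag V 0 w \<longleftrightarrow> V = {0} \<and> w = 1"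
  by (auto elim: flag.cases intro: flag_0)

lemma flag_homog: "flag V n w \<Longrightarrow> V \<subseteq> homog X 1 \<Longrightarrow> w \<in> homog X (2 * int n)"
proof (induction rule: flag.induct)
  case flag_0
  then show ?case using homog_cst[of 1 X] by (simp add: cst_simps)
next
  case (flag_Suc V n w u)
  have "w \<in> homog X (2 * int n)" "u \<in> homog X 1"
    using flag_Suc subset_ext in_ext flag_lin_closed by blast+
  then have "u * u * w \<in> homog X (1 + 1 + 2 * int n)"
    by (intro homog_mult)
  then show ?case by (simp add: power2_eq_square)
qed

text \<open>A form of the larger space is a form of the smaller one, which kills the smaller
  product, plus a multiple of the new vector u, for which u * u^2 = 0.\<close>

lemma flag_annihilated:
  assumes "flag V n w" "\<And>v. v \<in> V \<Longrightarrow> v ^ 3 = 0" "v \<in> V"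
  shows "v * w = 0"
  using assms
proof (induction arbitrary: v rule: flag.induct)
  case (flag_Suc V n w u)
  obtain v' c where v: "v = v' + cst c * u" "v' \<in> V" using flag_Suc.prems(2) by (auto simp: ext_def)
  have "v' * w = 0" using flag_Suc subset_ext v(2) by blast
  moreover have "u ^ 3 = 0" using flag_Suc in_ext flag_lin_closed by blast
  moreover have "v * (u ^ 2 * w) = u ^ 2 * (v' * w) + cst c * u ^ 3 * w"
    by (simp add: v algebra_simps power2_eq_square power3_eq_cube)
  ultimately show ?case by simp
qed auto

text \<open>Induction along the flag. If \<phi> is nonzero on V, the new vector u is corrected by a
  multiple of v to lie in the kernel, which grows by it; otherwise the kernel is V itself.\<close>

lemma flag_hyperplane:
  assumes "flag U n w" and u0: "u0 \<in> U" "\<phi> u0 \<noteq> (0::'a::field)"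
    and \<phi>: "\<And>u v. \<phi> (u + v) = \<phi> u + \<phi> v" "\<And>c u. \<phi> (cst c * u) = c * \<phi> u"
  shows "\<exists>m v w'. n = Suc m \<and> v \<in> U \<and> \<phi> v = 1 \<and> flag {u \<in> U. \<phi> u = 0} m w' \<and>
    U = ext {u \<in> U. \<phi> u = 0} v"
  using assms(1) u0
proof (induction arbitrary: u0 rule: flag.induct)
  case flag_0
  have "\<phi> 0 = 0" using \<phi>(2)[of 0 0] by simp
  then show ?case using flag_0 by auto
next
  case (flag_Suc V n w u)
  have lV: "lin_closed V" using flag_Suc.hyps(1) by (rule flag_lin_closed)
  note lE = lin_closed_ext[OF lV, of u]
  have \<phi>diff: "\<phi> (p - q) = \<phi> p - \<phi> q" for p q
    using \<phi>(1)[of "p - q" q] by simp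
  show ?case
  proof (cases "\<exists>u1\<in>V. \<phi> u1 \<noteq> 0")
    case True
    then obtain m v w' where IH: "n = Suc m" "v \<in> V" "\<phi> v = 1" "flag {u \<in> V. \<phi> u = 0} m w'"
      "V = ext {u \<in> V. \<phi> u = 0} v"
      using flag_Suc.IH by blast
    let ?K = "{u \<in> V. \<phi> u = 0}"
    define u' where "u' = u - cst (\<phi> u) * v"
    have cv: "cst (\<phi> u) * v \<in> V" using lV IH(2) by (simp add: lin_closedD)
    have \<phi>u': "\<phi> u' = 0" by (simp add: u'_def \<phi>diff \<phi> IH)
    have u'V: "u' \<notin> V" using lin_closedD(2)[OF lV _ cv, of u'] flag_Suc.hyps(2) by (auto simp: u'_def)
    have K: "{p \<in> ext V u. \<phi> p = 0} = ext ?K u'"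
    proof (intro subset_antisym subsetI)
      fix p assume p: "p \<in> {p \<in> ext V u. \<phi> p = 0}"
      then have "p \<in> ext V u'" unfolding u'_def ext_shift[OF lV cv] by simp
      then obtain q c where "p = q + cst c * u'" "q \<in> V" by (auto simp: ext_def)
      then show "p \<in> ext ?K u'" using p \<phi>u' by (auto simp: ext_def \<phi>)
    next
      fix p assume "p \<in> ext ?K u'"
      then obtain q c where pq: "p = q + cst c * u'" "q \<in> V" "\<phi> q = 0" by (auto simp: ext_def)
      then have "p \<in> ext V u'" by (auto simp: ext_def)
      then show "p \<in> {p \<in> ext V u. \<phi> p = 0}"
        using pq \<phi>u' unfolding u'_def ext_shift[OF lV cv] by (simp add: \<phi>)
    qed
    \<comment> \<open>Extensions by \<open>v\<close> and by \<open>u'\<close> commute, so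
      \<open>v\<close> may come last.\<close>
    have "ext V u = ext {p \<in> ext V u. \<phi> p = 0} v" unfolding K
      using ext_shift[OF lV cv, of u] IH(5) ext_commute unfolding u'_def by metis
    moreover have "flag {p \<in> ext V u. \<phi> p = 0} (Suc m) (u' ^ 2 * w')" unfolding K
      using IH(4) u'V by (intro flag.flag_Suc) auto
    moreover have "v \<in> ext V u" using IH(2) subset_ext by blast
    ultimately show ?thesis using IH(1,3) by blast
  next
    case False
    have Vext: "\<phi> p = c * \<phi> u" if "p = q + cst c * u" "q \<in> V" for p q c
      using that False by (simp add: \<phi>)
    obtain q0 c0 where "u0 = q0 + cst c0 * u" "q0 \<in> V" using flag_Suc.prems(1) by (auto simp: ext_def)
    with Vext flag_Suc.prems(2) have \<phi>u: "\<phi> u \<noteq> 0" by fastforce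
    have K: "{p \<in> ext V u. \<phi> p = 0} = V"
    proof (intro subset_antisym subsetI)
      fix p assume "p \<in> {p \<in> ext V u. \<phi> p = 0}"
      then obtain q c where "p = q + cst c * u" "q \<in> V" "\<phi> p = 0" by (auto simp: ext_def)
      then show "p \<in> V" using Vext \<phi>u by (fastforce simp: cst_simps)
    qed (use False subset_ext in blast)
    let ?v = "cst (1 / \<phi> u) * u"
    have "?v \<in> ext V u" using lE in_ext[OF lV] by (simp add: lin_closedD)
    moreover have "\<phi> ?v = 1" using \<phi>u by (simp add: \<phi>)
    moreover have "ext V u = ext V ?v"
    proof
      have "cst (\<phi> u) * ?v \<in> ext V ?v" using in_ext[OF lV] lin_closed_ext[OF lV] lin_closedD(3) by blast
      then have "u \<in> ext V ?v" using \<phi>u by (simp flip: mult.assoc cst_simps(2) add: cst_simps(6))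
      then show "ext V u \<subseteq> ext V ?v" by (intro ext_subset lin_closed_ext lV subset_ext)
      show "ext V ?v \<subseteq> ext V u" using \<open>?v \<in> ext V u\<close> by (intro ext_subset lE subset_ext)
    qed
    ultimately show ?thesis unfolding K using flag_Suc.hyps(1) by blast
  qed
qed

section \<open>Products of forms and the top power of a space\<close>

text \<open>The integer \<open>r\<close> may be negative; then zero is the only product.\<close>

inductive products :: "'a::field sqf set \<Rightarrow> int \<Rightarrow> 'a sqf \<Rightarrow> bool" for V where
  products_cst: "products V 0 (cst c)"
| products_zero: "products V r 0"
| products_add: "products V r f \<Longrightarrow> products V r g \<Longrightarrow> products V r (f + g)"
| products_mult: "v \<in> V \<Longrightarrow> products V r f \<Longrightarrow> products V (r + 1) (v * f)"

lemma products_cst_mult: "products V r f \<Longrightarrow> products V r (cst c * f)"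
proof (induction rule: products.induct)
  case (products_cst d)
  then show ?case using products.products_cst[of V "c * d"] by (simp add: cst_simps)
next
  case (products_mult v r f)
  then show ?case using products.products_mult[of v V r "cst c * f"] by (simp add: mult.left_commute)
qed (auto simp: distrib_left intro: products.intros)

lemma products_mono: "products V r f \<Longrightarrow> V \<subseteq> W \<Longrightarrow> products W r f"
  by (induction rule: products.induct) (auto intro: products.intros)

text \<open>Since u^3 = 0, only the powers 1, u and u^2 survive when a product is expanded in
  u.\<close>

lemma products_ext:
  assumes "products (ext V u) r f" "u ^ 3 = 0"
  shows "\<exists>q0 q1 q2. products V r q0 \<and> products V (r - 1) q1 \<and> products V (r - 2) q2 \<and>
    f = q0 + q1 * u + q2 * u ^ 2"
  using assms(1)
proof (induction rule: products.induct)
  case (products_cst c)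
  show ?case
    by (rule exI[of _ "cst c"], rule exI[of _ 0], rule exI[of _ 0]) (auto intro: products.intros)
next
  case (products_zero r)
  show ?case
    by (rule exI[of _ 0], rule exI[of _ 0], rule exI[of _ 0]) (auto intro: products.intros)
next
  case (products_add r f g)
  then obtain p0 p1 p2 q0 q1 q2 where
    "products V r p0" "products V (r - 1) p1" "products V (r - 2) p2" "f = p0 + p1 * u + p2 * u ^ 2"
    "products V r q0" "products V (r - 1) q1" "products V (r - 2) q2" "g = q0 + q1 * u + q2 * u ^ 2"
    by blast
  then show ?case
    by (intro exI[of _ "p0 + q0"] exI[of _ "p1 + q1"] exI[of _ "p2 + q2"])
      (auto intro: products.products_add simp: algebra_simps)
next
  case (products_mult p r f)
  then obtain q0 q1 q2 where q:
    "products V r q0" "products V (r - 1) q1" "products V (r - 2) q2" "f = q0 + q1 * u + q2 * u ^ 2"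
    by blast
  obtain v c where p: "p = v + cst c * u" "v \<in> V" using products_mult.hyps(1) by (auto simp: ext_def)
  have "products V (r + 1) (v * q0)"
    by (intro products.intros p q)
  moreover have "products V (r + 1 - 1) (v * q1 + cst c * q0)"
    using products.products_mult[OF p(2) q(2)] products_cst_mult[OF q(1)]
    by (auto intro: products.products_add)
  moreover have "products V (r + 1 - 2) (v * q2 + cst c * q1)"
    using products.products_mult[OF p(2) q(3)] products_cst_mult[OF q(2)]
    by (auto intro: products.products_add)
  moreover have "p * f = v * q0 + (v * q1 + cst c * q0) * u + (v * q2 + cst c * q1) * u ^ 2 + cst c * q2 * u ^ 3"
    unfolding p q by (simp add: algebra_simps power2_eq_square power3_eq_cube)
  ultimately show ?case using assms(2) by (metis add.right_neutral mult_zero_right)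
qed

text \<open>In the expansion in the last vector u, the coefficients of 1 and u are products of too
  many forms of the smaller space and vanish, and that of u^2 is a multiple of the smaller top
  product. So the 2n-fold products span the line of w.\<close>

lemma flag_products:
  assumes "flag V n w" "\<And>v. v \<in> V \<Longrightarrow> v ^ 3 = 0" "products V r f"
  shows "(r = 2 * int n \<longrightarrow> (\<exists>c. f = cst c * w)) \<and> (r > 2 * int n \<longrightarrow> f = 0)"
  using assms
proof (induction arbitrary: r f rule: flag.induct)
  case flag_0
  have "(r = 0 \<longrightarrow> (\<exists>c. f = cst c)) \<and> (r > 0 \<longrightarrow> f = 0)"
    using flag_0(2)
  proof (induction rule: products.induct)
    case (products_add r f g)
    then show ?case by (metis add.right_neutral cst_simps(1))
  qed (auto intro: exI[of _ 0] simp: cst_simps)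
  then show ?case by simp
next
  case (flag_Suc V n w u)
  have "u ^ 3 = 0" using flag_Suc in_ext flag_lin_closed by blast
  then obtain q0 q1 q2 where q:
    "products V r q0" "products V (r - 1) q1" "products V (r - 2) q2" "f = q0 + q1 * u + q2 * u ^ 2"
    using products_ext flag_Suc.prems(2) by blast
  have IH: "(r = 2 * int n \<longrightarrow> (\<exists>c. f = cst c * w)) \<and> (r > 2 * int n \<longrightarrow> f = 0)"
    if "products V r f" for r f
    using that flag_Suc.IH flag_Suc.prems(1) subset_ext by blast
  show ?case
  proof (intro conjI impI)
    assume r: "r = 2 * int (Suc n)"
    then obtain c where "q2 = cst c * w" using IH[OF q(3)] by auto
    moreover have "q0 = 0" "q1 = 0" using IH[OF q(1)] IH[OF q(2)] r by auto
    ultimately show "\<exists>c. f = cst c * (u ^ 2 * w)" using q(4) by (auto simp: mult_ac)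
  next
    assume "r > 2 * int (Suc n)"
    then show "f = 0" using IH[OF q(1)] IH[OF q(2)] IH[OF q(3)] q(4) by simp
  qed
qed

lemma products_flag: "flag V n w \<Longrightarrow> products V (2 * int n) w"
proof (induction rule: flag.induct)
  case flag_0
  then show ?case using products_cst[of _ 1] by (simp add: cst_simps)
next
  case (flag_Suc V n w u)
  have "products (ext V u) (2 * int n) w" using flag_Suc products_mono subset_ext by blast
  moreover have "u \<in> ext V u" using flag_Suc in_ext flag_lin_closed by blast
  ultimately have "products (ext V u) (2 * int n + 1 + 1) (u * (u * w))"
    by (intro products.intros)
  then show ?case by (simp add: power2_eq_square mult.assoc)
qed

text \<open>As w' is itself a product of 2n forms of V, it lies on the line spanned by w. Bases can
  therefore be changed at the cost of a scalar.\<close>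

lemma flag_unique:
  assumes "flag V n w" "flag V n w'" "\<And>v. v \<in> V \<Longrightarrow> v ^ 3 = 0"
  shows "\<exists>c. w' = cst c * w"
  using flag_products[OF assms(1,3) products_flag[OF assms(2)]] by simp

text \<open>The degree d part of the ideal generated by V in the variables of X, as finite sums with
  homogeneous coefficients, so that variables and degrees stay visible.\<close>

inductive ideal_part :: "nat set \<Rightarrow> 'a::field sqf set \<Rightarrow> int \<Rightarrow> 'a sqf \<Rightarrow> bool" for X V d where
  ideal_zero: "ideal_part X V d 0"
| ideal_step: "a \<in> homog X (d - 1) \<Longrightarrow> v \<in> V \<Longrightarrow> ideal_part X V d f \<Longrightarrow> ideal_part X V d (a * v + f)"

lemma ideal_part_mono: "ideal_part Y V d f \<Longrightarrow> Y \<subseteq> X \<Longrightarrow> V \<subseteq> U \<Longrightarrow> ideal_part X U d f"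
  by (induction rule: ideal_part.induct) (auto intro: ideal_part.intros homog_mono)

lemma ideal_part_annihilated: "ideal_part X V d f \<Longrightarrow> (\<And>v. v \<in> V \<Longrightarrow> v * w = 0) \<Longrightarrow> f * w = 0"
  by (induction rule: ideal_part.induct) (auto simp: distrib_right mult.assoc)

text \<open>Collecting the multiples of u peels one generator off the ideal.\<close>

lemma ideal_part_ext:
  assumes "ideal_part X (ext V u) d f"
  shows "\<exists>a\<in>homog X (d - 1). \<exists>g. ideal_part X V d g \<and> f = a * u + g"
  using assms
proof (induction rule: ideal_part.induct)
  case ideal_zero
  show ?case by (rule bexI[of _ 0]) (auto intro: ideal_part.intros)
next
  case (ideal_step a p f)
  then obtain b g where IH: "b \<in> homog X (d - 1)" "ideal_part X V d g" "f = b * u + g" by blast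
  obtain v c where p: "p = v + cst c * u" "v \<in> V" using ideal_step by (auto simp: ext_def)
  have "cst c * a + b \<in> homog X (d - 1)"
    using IH ideal_step by (intro homog_add homog_cst_mult)
  moreover have "ideal_part X V d (a * v + g)"
    using IH ideal_step p by (intro ideal_part.intros)
  moreover have "a * p + f = (cst c * a + b) * u + (a * v + g)"
    by (simp add: p IH algebra_simps)
  ultimately show ?case by blast
qed

section \<open>Supports\<close>

definition support :: "'a::field sqf set \<Rightarrow> nat set" where
  "support V = {x. \<exists>v\<in>V. coef v {x} \<noteq> 0}"

text \<open>All bounds ms_i(U) >= 4i - c at once, with the minimum unfolded. (A) corresponds to c =
  2 - 2k and (B) to c = 3 - 2k; deleting a variable raises \<open>c\<close> by 1, a generic
  hyperplane lowers it by 4.\<close>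

definition spread :: "'a::field sqf set \<Rightarrow> int \<Rightarrow> bool" where
  "spread U c \<longleftrightarrow> (\<forall>V i w. flag V i w \<longrightarrow> V \<subseteq> U \<longrightarrow> i \<ge> 1 \<longrightarrow> 4 * int i - c \<le> int (card (support V)))"

lemma spreadD: "spread U c \<Longrightarrow> flag V i w \<Longrightarrow> V \<subseteq> U \<Longrightarrow> i \<ge> 1 \<Longrightarrow> 4 * int i - c \<le> int (card (support V))"
  unfolding spread_def by blast

lemma spread_mono: "spread U c \<Longrightarrow> V \<subseteq> U \<Longrightarrow> c \<le> c' \<Longrightarrow> spread V c'"
  unfolding spread_def by (meson diff_left_mono order_trans subset_trans)

lemma support_subset: "V \<subseteq> homog X 1 \<Longrightarrow> support V \<subseteq> X"
  using homogD by (fastforce simp: support_def)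

text \<open>The line spanned by a variable has dimension 1 and support of size 1, so 4 - c \<le> 1.
  This serves to keep variables out of U.\<close>

lemma spread_var:
  assumes "spread U c" "var x \<in> U" "lin_closed U"
  shows "3 \<le> c"
proof -
  have 1: "flag (ext {0} (var x)) (Suc 0) (var x ^ 2 * 1)"
    by (intro flag.intros) (auto simp: var_nonzero)
  have 2: "ext {0} (var x) \<subseteq> U"
    using assms by (intro ext_subset) (auto simp: lin_closedD)
  have "4 * int (Suc 0) - c \<le> int (card (support (ext {0} (var x :: 'a sqf))))"
    using spreadD[OF assms(1) 1 2] by simp
  moreover have "card (support (ext {0} (var x :: 'a sqf))) \<le> card {x}"
    by (rule card_mono) (auto simp: support_def ext_def coef_var split: if_splits)
  ultimately show ?thesis by simp
qed

lemma spread_support_nonempty: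
  assumes "spread U c" "flag U n w" "n \<ge> 1" "c < 4"
  shows "support U \<noteq> {}"
proof -
  have "4 * int n - c \<le> int (card (support U))" using spreadD[OF assms(1,2)] assms by blast
  then have "card (support U) \<noteq> 0" using assms by linarith
  then show ?thesis by auto
qed

lemma del_ext: "del x ` ext V u = ext (del x ` V) (del x u)"
proof (intro subset_antisym subsetI)
  fix p assume "p \<in> del x ` ext V u"
  then obtain v c where "p = del x (v + cst c * u)" "v \<in> V" by (auto simp: ext_def)
  then show "p \<in> ext (del x ` V) (del x u)"
    using extI[of "del x v" "del x ` V" c "del x u"] by (simp add: del_simps)
next
  fix p assume "p \<in> ext (del x ` V) (del x u)"
  then obtain v c where "p = del x v + cst c * del x u" "v \<in> V" by (auto simp: ext_def)
  then show "p \<in> del x ` ext V u"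
    using extI[of v V c u] by (auto simp flip: del_simps)
qed

text \<open>Preimages are chosen one basis vector at a time; a preimage lying in \<open>V'\<close>
  would have its image in V, so independence persists.\<close>

lemma flag_del_lift:
  assumes "flag V i w" "V \<subseteq> del x ` U" "lin_closed U"
  shows "\<exists>V' w'. flag V' i w' \<and> V' \<subseteq> U \<and> del x ` V' = V"
  using assms
proof (induction rule: flag.induct)
  case flag_0
  have "{0} \<subseteq> U" using lin_closedD(1)[OF flag_0(2)] by simp
  moreover have "del x ` {0} = {0}" by (simp add: del_simps)
  ultimately show ?case using flag.flag_0 by blast
next
  case (flag_Suc V n w u)
  have "V \<subseteq> del x ` U" "u \<in> del x ` U"
    using flag_Suc.prems(1) subset_ext in_ext[OF flag_lin_closed[OF flag_Suc.hyps(1)]]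
    by (meson subset_trans, meson subsetD)
  from flag_Suc.IH[OF this(1) flag_Suc.prems(2)] this(2) obtain V' w' u'
    where *: "flag V' n w'" "V' \<subseteq> U" "del x ` V' = V" "u' \<in> U" "u = del x u'"
    by (elim exE conjE imageE) (rule that)
  then have "u' \<notin> V'" using flag_Suc.hyps by blast
  then have "flag (ext V' u') (Suc n) (u' ^ 2 * w')" using * by (intro flag.intros)
  moreover have "ext V' u' \<subseteq> U" using * flag_Suc by (intro ext_subset)
  moreover have "del x ` ext V' u' = ext V u"
    by (simp add: del_ext *(3,5))
  ultimately show ?case by blast
qed

text \<open>A subspace of the image lifts to a subspace of U of the same dimension, whose support
  exceeds the given one by at most x.\<close>

lemma spread_del:
  assumes "spread U c" "lin_closed U" "U \<subseteq> homog X 1" "finite X"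
  shows "spread (del x ` U) (c + 1)"
  unfolding spread_def
proof (intro allI impI)
  fix V i and w :: "'a sqf" assume V: "flag V i w" "V \<subseteq> del x ` U" "1 \<le> i"
  then obtain V' w' where V': "flag V' i w'" "V' \<subseteq> U" "del x ` V' = V"
    using flag_del_lift assms(2) by blast
  have "support V' \<subseteq> insert x (support V)"
    unfolding V'(3)[symmetric] by (auto simp: support_def coef_del)
  moreover have "support V \<subseteq> X - {x}"
    using del_homog V(2) assms(3) by (intro support_subset) blast
  then have "finite (support V)" using assms(4) finite_subset by blast
  ultimately have "card (support V') \<le> card (insert x (support V))"
    by (intro card_mono) auto
  also have "\<dots> \<le> Suc (card (support V))"
    using \<open>finite (support V)\<close> by (simp add: card_insert_if)
  finally have "card (support V') \<le> Suc (card (support V))" .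
  then show "4 * int i - (c + 1) \<le> int (card (support V))"
    using spreadD[OF assms(1) V'(1,2) V(3)] by linarith
qed

text \<open>A hyperplane \<open>H\<close> that avoids one chosen vector \<open>e T\<close> of each nonzero coordinate subspace
  of \<open>U\<close>: a subspace \<open>V\<close> of \<open>H\<close> with support \<open>T\<close> can then be enlarged by \<open>e T\<close>.\<close>

lemma generic_hyperplane:
  fixes U :: "'a::field sqf set"
  assumes "infinite (UNIV :: 'a set)" "spread U c" "lin_closed U" "U \<subseteq> homog X 1" "finite X"
    and u0: "u0 \<in> U" "u0 \<noteq> 0"
  obtains \<phi> u1 where "\<forall>u v. \<phi> (u + v) = \<phi> u + \<phi> v" "\<forall>c u. \<phi> (cst c * u) = c * \<phi> u"
    "u1 \<in> U" "\<phi> u1 \<noteq> (0::'a)" "spread {u \<in> U. \<phi> u = 0} (c - 4)"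
proof -
  \<comment> \<open>The functionals are u -> p_u(t), where p_u has the coordinates of u as
    coefficients. For u nonzero, p_u is nonzero and rules out finitely many t.\<close>
  define p where "p u = (\<Sum>i\<in>X. monom (coef u {i}) i)" for u :: "'a sqf"
  have pnz: "p u \<noteq> 0" if u: "u \<in> homog X 1" "u \<noteq> 0" for u
  proof -
    obtain S where S: "coef u S \<noteq> 0" using u(2) by (metis sqf_eqI coef_ring(1))
    then obtain i where i: "i \<in> X" "S = {i}"
      using homogD[OF u(1) S] by (auto simp: card_1_singleton_iff)
    have "Polynomial.coeff (p u) i = coef u {i}"
      using i assms(5) by (simp add: p_def coeff_sum sum.delta)
    then show ?thesis using S i by auto
  qed
  define \<phi> where "\<phi> t u = poly (p u) t" for t :: 'a and u
  have \<phi>: "\<phi> t (u + v) = \<phi> t u + \<phi> t v" "\<phi> t (cst c * u) = c * \<phi> t u" for t u v c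
    by (simp_all add: \<phi>_def p_def poly_sum poly_monom sum.distrib sum_distrib_left distrib_right mult.assoc)
  define e where "e T = (SOME u. u \<in> U \<and> u \<noteq> 0 \<and> support {u} \<subseteq> T)" for T
  have e: "e T \<in> U \<and> e T \<noteq> 0 \<and> support {e T} \<subseteq> T" if "u \<in> U" "u \<noteq> 0" "support {u} \<subseteq> T" for T u
    unfolding e_def by (rule someI[of _ u]) (use that in simp)
  define E where "E = {e T | T. T \<subseteq> X} \<inter> {u \<in> U. u \<noteq> 0}"
  have "finite E" unfolding E_def using assms(5) by simp
  moreover have "finite {t. \<phi> t u = 0}" if "u \<in> E" for u
    unfolding \<phi>_def using that assms(4) by (intro poly_roots_finite pnz) (auto simp: E_def)
  ultimately have "finite (\<Union>u\<in>E. {t. \<phi> t u = 0})" by simp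
  \<comment> \<open>X has finitely many subsets, so finitely many vectors \<open>e T\<close> must be
    avoided, and the field is infinite.\<close>
  then obtain t where t: "\<forall>u\<in>E. \<phi> t u \<noteq> 0"
    using assms(1) by (metis (mono_tags, lifting) UNIV_eq_I UN_iff mem_Collect_eq)
  have avoid: "e T \<in> U \<and> e T \<noteq> 0 \<and> support {e T} \<subseteq> T \<and> \<phi> t (e T) \<noteq> 0"
    if "u \<in> U" "u \<noteq> 0" "support {u} \<subseteq> T" "T \<subseteq> X" for T u
    using e[OF that(1-3)] t that(4) unfolding E_def by blast
  show ?thesis
  proof (rule that[of "\<phi> t" "e X"])
    have "support {u0} \<subseteq> X" using u0 assms(4) by (intro support_subset) blast
    then show "e X \<in> U" "\<phi> t (e X) \<noteq> 0" using avoid u0 by blast+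
    show "spread {u \<in> U. \<phi> t u = 0} (c - 4)"
      unfolding spread_def
    proof (intro allI impI)
      fix V i and w :: "'a sqf" assume V: "flag V i w" "V \<subseteq> {u \<in> U. \<phi> t u = 0}" "1 \<le> i"
      let ?T = "support V"
      obtain u where u: "u \<in> V" "u \<noteq> 0"
        using V(1,3) by (cases rule: flag.cases) (auto intro: in_ext flag_lin_closed subset_ext lin_closedD dest: flag_lin_closed)
      have TX: "?T \<subseteq> X" using V(2) assms(4) by (intro support_subset) blast
      have "support {u} \<subseteq> ?T" using u by (auto simp: support_def)
      then have eT: "e ?T \<in> U" "support {e ?T} \<subseteq> ?T" "\<phi> t (e ?T) \<noteq> 0"
        using avoid[of u ?T] u V(2) TX by blast+
      \<comment> \<open>The dimension grows to i + 1 while the support stays within T, so the bound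
        for i + 1 applies to T itself.\<close>
      then have "flag (ext V (e ?T)) (Suc i) (e ?T ^ 2 * w)"
        using V by (intro flag.intros) auto
      moreover have "ext V (e ?T) \<subseteq> U" using V eT assms(3) by (intro ext_subset) auto
      ultimately have "4 * int (Suc i) - c \<le> int (card (support (ext V (e ?T))))"
        using spreadD[OF assms(2), of "ext V (e ?T)" "Suc i"] by simp
      moreover have "support (ext V (e ?T)) \<subseteq> ?T"
        using eT(2) by (fastforce simp: support_def ext_def)
      then have "card (support (ext V (e ?T))) \<le> card ?T"
        using TX assms(5) by (intro card_mono) (auto intro: finite_subset)
      ultimately show "4 * int i - (c - 4) \<le> int (card ?T)" by simp
    qed
  qed (use \<phi> in auto)
qed

section \<open>Exactness in low degrees\<close>

text \<open>The inclusion of Ann(w) in (U); the reverse one follows at the end from U w = 0.\<close>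

definition exact_A :: "nat set \<Rightarrow> 'a::field sqf set \<Rightarrow> 'a sqf \<Rightarrow> int \<Rightarrow> bool" where
  "exact_A X U w k \<longleftrightarrow> (\<forall>f\<in>homog X k. f * w = 0 \<longrightarrow> ideal_part X U k f)"

text \<open>As w has degree 2n, the cofactor has degree k - 2; for k < 2 the claim is f = 0.\<close>

definition exact_B :: "nat set \<Rightarrow> 'a::field sqf set \<Rightarrow> nat \<Rightarrow> 'a sqf \<Rightarrow> int \<Rightarrow> bool" where
  "exact_B X U n w k \<longleftrightarrow>
    (\<forall>f\<in>homog X (2 * int n - 2 + k). (\<forall>u\<in>U. f * u = 0) \<longrightarrow> (\<exists>b\<in>homog X (k - 2). f = b * w))"

text \<open>The measure falls when a variable is deleted or a hyperplane is taken. The degree k is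
  quantified because the steps also call on k + 2, k + 1 and k - 1.\<close>

definition exact_below :: "'a::field itself \<Rightarrow> nat \<Rightarrow> bool" where
  "exact_below TYPE('a) N \<longleftrightarrow> (\<forall>X (U :: 'a sqf set) n w k.
    finite X \<longrightarrow> U \<subseteq> homog X 1 \<longrightarrow> flag U n w \<longrightarrow> card X + n < N \<longrightarrow>
    (spread U (2 - 2 * k) \<longrightarrow> exact_A X U w k) \<and>
    (k \<ge> 0 \<longrightarrow> spread U (3 - 2 * k) \<longrightarrow> exact_B X U n w k))"

lemma exact_below_A:
  assumes "exact_below TYPE('a::field) N" "finite X" "U \<subseteq> homog X 1" "flag (U :: 'a sqf set) n w"
    "card X + n < N" "spread U c" "c \<le> 2 - 2 * k" "f \<in> homog X k" "f * w = 0"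
  shows "ideal_part X U k f"
proof -
  have "spread U (2 - 2 * k)" using assms(6,7) spread_mono by blast
  then show ?thesis using assms unfolding exact_below_def exact_A_def by blast
qed

lemma exact_below_B:
  assumes "exact_below TYPE('a::field) N" "finite X" "U \<subseteq> homog X 1" "flag (U :: 'a sqf set) n w"
    "card X + n < N" "spread U c" "c \<le> 3 - 2 * k" "0 \<le> k" "f \<in> homog X d" "d = 2 * int n - 2 + k"
    "\<And>u. u \<in> U \<Longrightarrow> f * u = 0"
  shows "\<exists>b\<in>homog X (k - 2). f = b * w"
proof -
  have "spread U (3 - 2 * k)" using assms(6,7) spread_mono by blast
  then show ?thesis using assms unfolding exact_below_def exact_B_def by blast
qed

text \<open>\<open>flag_hyperplane\<close> for the coefficient of x. Forms of V do not involve x, so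
  deleting x fixes V and sends u to v.\<close>

lemma coordinate_split:
  fixes U :: "'a::field sqf set"
  assumes "flag U n w" "U \<subseteq> homog X 1" "x \<in> support U"
  obtains m V u v w' where "n = Suc m" "V = {u \<in> U. coef u {x} = 0}" "flag V m w'"
    "u \<in> U" "u \<notin> V" "U = ext V u" "V \<subseteq> homog (X - {x}) 1" "v \<in> homog (X - {x}) 1" "u = v + var x"
    "del x ` U = ext V v"
proof -
  obtain u0 where u0: "u0 \<in> U" "coef u0 {x} \<noteq> 0" using assms(3) by (auto simp: support_def)
  define V where "V = {u \<in> U. coef u {x} = 0}"
  obtain m u w' where 1: "n = Suc m" "u \<in> U" "coef u {x} = 1" "flag V m w'" "U = ext V u"
    using flag_hyperplane[OF assms(1), of u0 "\<lambda>u. coef u {x}"] u0 unfolding V_def by auto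
  have V: "del x v = v" if "v \<in> V" for v
  proof -
    from that have "v \<in> homog X 1" "coef v {x} = 0" using assms(2) by (auto simp: V_def)
    then show ?thesis using del_linear[of v X x] by (simp add: cst_simps)
  qed
  have 2: "V \<subseteq> homog (X - {x}) 1"
  proof
    fix v assume v: "v \<in> V"
    then have "v \<in> homog X 1" using assms(2) by (auto simp: V_def)
    then show "v \<in> homog (X - {x}) 1" using del_homog[of v X 1 x] V[OF v] by simp
  qed
  have uX: "u \<in> homog X 1" using 1 assms(2) by blast
  have 3: "u = del x u + var x" using del_linear[OF uX, of x] 1(3) by (simp add: cst_simps)
  have "del x ` V = V" using V by force
  then have "del x ` ext V u = ext V (del x u)" by (simp add: del_ext)
  then have 4: "del x ` U = ext V (del x u)" using 1(5) by simp
  have 5: "u \<notin> V" using 1(3) by (simp add: V_def)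
  show ?thesis
    by (rule that[OF 1(1) V_def 1(4,2) 5 1(5) 2 del_homog[OF uX] 3 4])
qed

section \<open>The inductive steps for (A) and (B)\<close>

lemma homog_square: "v \<in> homog X 1 \<Longrightarrow> v ^ 2 \<in> homog X 2"
  using homog_mult[of v X 1 v 1] by (simp add: power2_eq_square)

text \<open>The coefficient of x in (g + x h) (v + x)^2 r is (2 g v + h v^2) r, which modulo 3 is
  -(g - h v) v r.\<close>

lemma split_square:
  fixes g h v r :: "'a::field sqf"
  assumes char: "CHAR('a) = 3" and g: "g \<in> homog Y k" and h: "h \<in> homog Y (k - 1)"
    and v: "v \<in> homog Y 1" and r: "r \<in> homog Y d" and x: "x \<notin> Y"
    and 0: "(g + var x * h) * ((v + var x) ^ 2 * r) = 0"
  shows "(g - h * v) * v * r = 0"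
proof -
  let ?x = "var x :: 'a sqf"
  have "(g + ?x * h) * ((v + ?x) ^ 2 * r) = g * v ^ 2 * r + ?x * ((2 * g * v + h * v ^ 2) * r)
    + (?x * ?x) * (g * r + (2 * v * h + ?x * h) * r)"
    by (simp add: algebra_simps power2_eq_square)
  then have "g * v ^ 2 * r + ?x * ((2 * g * v + h * v ^ 2) * r) = 0"
    using 0 by (simp add: var_square)
  moreover have "g * v ^ 2 * r \<in> homog Y (k + 2 + d)"
    by (intro homog_mult g r homog_square v)
  moreover have "(2 * g * v + h * v ^ 2) * r \<in> homog Y (k + 1 + d)"
  proof -
    have "g * v \<in> homog Y (k + 1)" using g v by (intro homog_mult)
    moreover have "h * v ^ 2 \<in> homog Y (k + 1)"
      using homog_mult[OF h homog_square[OF v]] by (simp add: algebra_simps)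
    ultimately have "g * v + g * v + h * v ^ 2 \<in> homog Y (k + 1)" by (intro homog_add)
    then show ?thesis using r by (intro homog_mult) (simp add: mult.assoc flip: mult_2)
  qed
  ultimately have "(2 * g * v + h * v ^ 2) * r = 0" using split_unique(2) x by blast
  moreover have "(g - h * v) * v * r = 3 * (g * v * r) - (2 * g * v + h * v ^ 2) * r"
    by (simp add: algebra_simps power2_eq_square)
  ultimately show ?thesis using three_eq_zero[OF char] by simp
qed

lemma step_A:
  fixes U :: "'a::field sqf set"
  assumes char: "CHAR('a) = 3" and fin: "finite X" and UX: "U \<subseteq> homog X 1" and U: "flag U n w"
    and IH: "exact_below TYPE('a) (card X + n)" and spr: "spread U (2 - 2 * k)"
  shows "exact_A X U w k"
  unfolding exact_A_def
proof (intro ballI impI)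
  fix f assume f: "f \<in> homog X k" "f * w = 0"
  note cube = linear_cube[OF char]
  consider "k < 0" | "n = 0" | "k \<ge> 0" "n \<ge> 1" by linarith
  then show "ideal_part X U k f"
  proof cases
    case 1
    then show ?thesis using homog_neg f(1) ideal_zero by metis
  next
    case 2
    then show ?thesis using U f(2) by (simp add: flag_0_iff ideal_zero)
  next
    case 3
    obtain x where x: "x \<in> support U"
      using spread_support_nonempty[OF spr U 3(2)] 3(1) by auto
    then have xX: "x \<in> X" using support_subset[OF UX] by blast
    obtain m V u v w0 where *: "n = Suc m" "V = {u \<in> U. coef u {x} = 0}" "flag V m w0"
      "u \<in> U" "u \<notin> V" "U = ext V u" "V \<subseteq> homog (X - {x}) 1" "v \<in> homog (X - {x}) 1"
      "u = v + var x" "del x ` U = ext V v"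
      by (rule coordinate_split[OF U UX x]) (rule that)
    let ?Y = "X - {x}" and ?x = "var x :: 'a sqf"
    note lU = flag_lin_closed[OF U]
    have finY: "finite ?Y" and cY: "card ?Y < card X"
      using fin card_Diff1_less[OF fin xX] by auto
    have "flag U n (u ^ 2 * w0)" unfolding *(1) *(6) by (intro flag.intros *)
    then obtain c where c: "u ^ 2 * w0 = cst c * w"
      using flag_unique[OF U] cube[OF fin] UX by blast
    have fw: "f * (u ^ 2 * w0) = 0" unfolding c using f(2) by (metis mult.left_commute mult_zero_right)
    obtain g h where gh: "g \<in> homog ?Y k" "h \<in> homog ?Y (k - 1)" "f = g + ?x * h"
      using homog_split[OF f(1)] by blast
    \<comment> \<open>Since v = u - x, f = y + h u: modulo u, the element y represents f without
      x.\<close>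
    define y where "y = g - h * v"
    have y: "y \<in> homog ?Y k" unfolding y_def
      using gh homog_mult'[OF gh(2) *(8)] by (intro homog_diff) auto
    have w0: "w0 \<in> homog ?Y (2 * int m)" using flag_homog *(3,7) by blast
    have "y * v * w0 = 0"
      unfolding y_def using fw unfolding gh(3) *(9)
      by (intro split_square[OF char gh(1,2) *(8) w0]) auto
    \<comment> \<open>Otherwise x = u - v lies in U, which forces 3 \<le> 2 - 2k.\<close>
    have vV: "v \<notin> V"
    proof
      assume "v \<in> V"
      then have "u - v \<in> U" using lin_closedD(4)[OF lU *(4)] *(2) by blast
      then have "var x \<in> U" by (simp add: *(9))
      then show False using spread_var[OF spr _ lU] 3 by fastforce
    qed
    have flagU': "flag (ext V v) n (v ^ 2 * w0)" unfolding *(1) by (intro flag.intros * vV)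
    have U'Y: "ext V v \<subseteq> homog ?Y 1" unfolding *(10)[symmetric] using del_homog UX by blast
    \<comment> \<open>The degree 2m + k equals 2n - 2 + k, and deletion turns 2 - 2k into 3 - 2k,
      the bound of (B).\<close>
    have "\<exists>b\<in>homog ?Y (k - 2). y * w0 = b * (v ^ 2 * w0)"
    proof (rule exact_below_B[OF IH finY U'Y flagU'])
      show "spread (ext V v) (2 - 2 * k + 1)"
        unfolding *(10)[symmetric] by (rule spread_del[OF spr lU UX fin])
      show "y * w0 \<in> homog ?Y (k + 2 * int m)" using y w0 by (rule homog_mult)
      fix p assume "p \<in> ext V v"
      then obtain q a where p: "p = q + cst a * v" "q \<in> V" by (auto simp: ext_def)
      have "q * w0 = 0" using flag_annihilated[OF *(3) _ p(2)] cube[OF finY] *(7) by blast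
      moreover have "y * w0 * p = y * (q * w0) + cst a * (y * v * w0)"
        unfolding p by (simp add: algebra_simps)
      ultimately show "y * w0 * p = 0" using \<open>y * v * w0 = 0\<close> by simp
    qed (use cY 3 * in auto)
    then obtain b where b: "b \<in> homog ?Y (k - 2)" "y * w0 = b * (v ^ 2 * w0)" by blast
    have "ideal_part ?Y V k (y - b * v ^ 2)"
    proof (rule exact_below_A[OF IH finY *(7) *(3)])
      show "spread V (2 - 2 * k)" by (rule spread_mono[OF spr]) (auto simp: *(2))
      show "y - b * v ^ 2 \<in> homog ?Y k"
        using y homog_mult[OF b(1) homog_square[OF *(8)]] by (intro homog_diff) auto
      show "(y - b * v ^ 2) * w0 = 0" using b(2) by (simp add: algebra_simps)
    qed (use cY * in auto)
    then have "ideal_part X U k (y - b * v ^ 2)"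
      by (rule ideal_part_mono) (auto simp: *(2))
    \<comment> \<open>Here v^2 = (u - x)^2 = u (u - 2x), so f = (y - b v^2) + (b (u - 2x) + h)
      u.\<close>
    moreover have "b * (u - (?x + ?x)) + h \<in> homog X (k - 1)"
    proof -
      have "u \<in> homog X 1" "?x \<in> homog X 1" using * UX xX homog_var by auto
      then have "u - (?x + ?x) \<in> homog X 1" by (intro homog_diff homog_add)
      then have "b * (u - (?x + ?x)) \<in> homog X (k - 2 + 1)"
        using homog_mono[OF b(1), of X] by (intro homog_mult) auto
      then show ?thesis using homog_mono[OF gh(2), of X] by (intro homog_add) auto
    qed
    ultimately have "ideal_part X U k ((b * (u - (?x + ?x)) + h) * u + (y - b * v ^ 2))"
      using *(4) by (intro ideal_step)
    moreover have "(b * (u - (?x + ?x)) + h) * u + (y - b * v ^ 2) = f - (?x * ?x) * b"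
      unfolding gh(3) y_def *(9) by (simp add: algebra_simps power2_eq_square)
    ultimately show ?thesis by (simp add: var_square)
  qed
qed

text \<open>The base case, with U the line of u = v + x. From f u = 0 follow g = -h v and h v^2 = 0;
  then (A) for the line of v gives h = a v, so f = -a u^2.\<close>

lemma step_B_line:
  fixes U :: "'a::field sqf set"
  assumes char: "CHAR('a) = 3" and fin: "finite X" and UX: "U \<subseteq> homog X 1" and U: "flag U 1 w"
    and IH: "exact_below TYPE('a) (card X + 1)" and k: "k \<ge> 0" and spr: "spread U (3 - 2 * k)"
  shows "exact_B X U 1 w k"
  unfolding exact_B_def
proof (intro ballI impI)
  fix f assume "f \<in> homog X (2 * int 1 - 2 + k)" and fU: "\<forall>u\<in>U. f * u = 0"
  then have f: "f \<in> homog X k" by simp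
  note cube = linear_cube[OF char]
  note three = three_eq_zero[OF char]
  obtain x where x: "x \<in> support U"
    using spread_support_nonempty[OF spr U order_refl] k by auto
  then have xX: "x \<in> X" using support_subset[OF UX] by blast
  obtain m V u v w0 where *: "1 = Suc m" "V = {u \<in> U. coef u {x} = 0}" "flag V m w0"
    "u \<in> U" "u \<notin> V" "U = ext V u" "V \<subseteq> homog (X - {x}) 1" "v \<in> homog (X - {x}) 1"
    "u = v + var x" "del x ` U = ext V v"
    by (rule coordinate_split[OF U UX x]) (rule that)
  let ?Y = "X - {x}" and ?x = "var x :: 'a sqf"
  have V0: "V = {0}" "w0 = 1" using * by (auto simp: flag_0_iff)
  note lU = flag_lin_closed[OF U]
  have finY: "finite ?Y" and cY: "card ?Y < card X"
    using fin card_Diff1_less[OF fin xX] by auto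
  have "flag U 1 (u ^ 2 * w0)" unfolding *(1) unfolding *(6) by (intro flag.intros *)
  then obtain c where c: "u ^ 2 = cst c * w"
    using flag_unique[OF U] cube[OF fin] UX V0 by fastforce
  obtain g h where gh: "g \<in> homog ?Y k" "h \<in> homog ?Y (k - 1)" "f = g + ?x * h"
    using homog_split[OF f] by blast
  have "f * u = g * v + ?x * (g + h * v) + (?x * ?x) * h"
    unfolding gh *(9) by (simp add: algebra_simps)
  then have "g * v + ?x * (g + h * v) = 0" using fU *(4) by (simp add: var_square)
  moreover have "h * v \<in> homog ?Y k" using homog_mult[OF gh(2) *(8)] by simp
  then have "g + h * v \<in> homog ?Y k" using gh(1) by (intro homog_add)
  ultimately have gv: "g * v = 0" "g + h * v = 0"
    using split_unique[of "g * v" x "g + h * v" ?Y "k + 1" ?Y k] homog_mult[OF gh(1) *(8)] by auto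
  have g: "g = - (h * v)" using gv(2) by (simp add: eq_neg_iff_add_eq_0)
  have hv2: "h * v ^ 2 = 0" using gv(1) unfolding g by (simp add: power2_eq_square mult.assoc)
  show "\<exists>b\<in>homog X (k - 2). f = b * w"
  \<comment> \<open>For k = 0 the degree of h is -1, so h = 0; for k \<ge> 1 the bound 3 - 2k < 3
    keeps x out of U.\<close>
  proof (cases "k = 0")
    case True
    then have "h = 0" using gh(2) homog_neg by fastforce
    then have "f = 0 * w" using gh g by simp
    then show ?thesis using homog_zero by blast
  next
    case False
    have vV: "v \<notin> V"
    proof
      assume "v \<in> V"
      then have "?x \<in> U" using *(4,9) V0 by simp
      then show False using spread_var[OF spr _ lU] k False by fastforce
    qed
    have flagU': "flag (ext V v) 1 (v ^ 2 * w0)" unfolding *(1) by (intro flag.intros * vV)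
    have U'Y: "ext V v \<subseteq> homog ?Y 1" unfolding *(10)[symmetric] using del_homog UX by blast
    have "ideal_part ?Y (ext V v) (k - 1) h"
    proof (rule exact_below_A[OF IH finY U'Y flagU'])
      show "spread (ext V v) (3 - 2 * k + 1)"
        \<comment> \<open>3 - 2k + 1 = 2 - 2(k - 1), the bound of (A) in degree k - 1.\<close>
        unfolding *(10)[symmetric] by (rule spread_del[OF spr lU UX fin])
      show "h * (v ^ 2 * w0) = 0" using hv2 V0 by simp
    qed (use cY gh in auto)
    then obtain a r where a: "a \<in> homog ?Y (k - 1 - 1)" "ideal_part ?Y V (k - 1) r" "h = a * v + r"
      using ideal_part_ext by blast
    have "r * 1 = 0" by (rule ideal_part_annihilated[OF a(2)]) (simp add: V0)
    then have h: "h = a * v" using a(3) by simp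
    have "f = - a * u ^ 2 + 3 * (a * ?x * v) + (?x * ?x) * a"
      unfolding gh(3) g h *(9) by (simp add: algebra_simps power2_eq_square)
    then have "f = (cst (- c) * a) * w" using three c by (simp add: var_square cst_simps mult_ac)
    moreover have "cst (- c) * a \<in> homog X (k - 2)"
      using a(1) homog_mono[of a ?Y "k - 2" X] by (intro homog_cst_mult) auto
    ultimately show ?thesis by blast
  qed
qed

lemma step_B_plane:
  fixes U :: "'a::field sqf set"
  assumes inf: "infinite (UNIV :: 'a set)"
    and char: "CHAR('a) = 3" and fin: "finite X" and UX: "U \<subseteq> homog X 1" and U: "flag U n w"
    and IH: "exact_below TYPE('a) (card X + n)" and k: "k \<ge> 0" and spr: "spread U (3 - 2 * k)"
    and n: "n \<ge> 2"
  shows "exact_B X U n w k"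
  unfolding exact_B_def
proof (intro ballI impI)
  fix f assume f: "f \<in> homog X (2 * int n - 2 + k)" and fU: "\<forall>u\<in>U. f * u = 0"
  note cube = linear_cube[OF char]
  note lU = flag_lin_closed[OF U]
  obtain x0 u0 where "u0 \<in> U" "coef u0 {x0} \<noteq> 0"
    using spread_support_nonempty[OF spr U] n k by (auto simp: support_def)
  then have u0: "u0 \<in> U" "u0 \<noteq> 0" by auto
  obtain \<phi> u1 where \<phi>: "\<forall>u v. \<phi> (u + v) = \<phi> u + \<phi> v" "\<forall>c u. \<phi> (cst c * u) = c * \<phi> u"
    and u1: "u1 \<in> U" "\<phi> u1 \<noteq> 0" and sprH0: "spread {u \<in> U. \<phi> u = 0} (3 - 2 * k - 4)"
    by (rule generic_hyperplane[OF inf spr lU UX fin u0]) (rule that)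
  define H where "H = {u \<in> U. \<phi> u = 0}"
  have sprH: "spread H (- 1 - 2 * k)" using sprH0 by (simp add: H_def)
  obtain m p wH where p: "n = Suc m" "p \<in> U" "\<phi> p = 1" "flag H m wH" "U = ext H p"
    using flag_hyperplane[OF U u1 \<phi>[rule_format]] unfolding H_def by blast
  have m: "m \<ge> 1" using p(1) n by simp
  have HU: "H \<subseteq> U" by (auto simp: H_def)
  then have HX: "H \<subseteq> homog X 1" using UX by blast
  note lH = flag_lin_closed[OF p(4)]
  \<comment> \<open>With n = m + 1 the degree of f is 2m - 2 + (k + 2), and 3 - 2k - 4 = 3 - 2(k +
    2). Here n drops and X stays.\<close>
  have "\<exists>b\<in>homog X (k + 2 - 2). f = b * wH"
    by (rule exact_below_B[OF IH fin HX p(4) _ sprH _ _ f]) (use p k fU HU in auto)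
  then obtain c0 where c0: "c0 \<in> homog X k" "f = c0 * wH" by auto
  obtain x where x: "x \<in> support H"
    using spread_support_nonempty[OF sprH p(4) m] k by auto
  then have xX: "x \<in> X" using support_subset[OF HX] by blast
  obtain l L q z wL where *: "m = Suc l" "L = {u \<in> H. coef u {x} = 0}" "flag L l wL"
      "q \<in> H" "q \<notin> L" "H = ext L q" "L \<subseteq> homog (X - {x}) 1" "z \<in> homog (X - {x}) 1"
      "q = z + var x" "del x ` H = ext L z"
    by (rule coordinate_split[OF p(4) HX x]) (rule that)
  let ?Y = "X - {x}" and ?x = "var x :: 'a sqf"
  have finY: "finite ?Y" and cY: "card ?Y < card X"
    using fin card_Diff1_less[OF fin xX] by auto
  have LH: "L \<subseteq> H" by (auto simp: *(2))
  have Lann: "s * wL = 0" if "s \<in> L" for s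
    using flag_annihilated[OF *(3) _ that] cube[OF finY] *(7) by blast
  have wL: "wL \<in> homog ?Y (2 * int l)" using flag_homog *(3,7) by blast
  have "flag H m (q ^ 2 * wL)" unfolding *(1) *(6) by (intro flag.intros *)
  then obtain c1 where c1: "wH = cst c1 * (q ^ 2 * wL)"
    using flag_unique[OF _ p(4)] cube[OF fin] HX by blast
  define c where "c = cst c1 * c0"
  have c: "c \<in> homog X k" "f = c * (q ^ 2 * wL)"
    using c0 c1 by (auto simp: c_def intro: homog_cst_mult)

  define a where "a = coef p {x}"
  \<comment> \<open>Subtracting a multiple of q removes x from p, and the result still completes H
    to U.\<close>
  define u where "u = p - cst a * q"
  have aq: "cst a * q \<in> H" using lin_closedD(3)[OF lH *(4)] .
  then have uU: "u \<in> U" unfolding u_def using lin_closedD(4)[OF lU p(2)] HU by blast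
  have uH: "u \<notin> H"
  proof
    assume "u \<in> H"
    then have "u + cst a * q \<in> H" using lin_closedD(2)[OF lH _ aq] by blast
    then show False using p(3) by (simp add: u_def H_def)
  qed
  have "coef z {x} = 0" using homogD[OF *(8), of "{x}"] by blast
  then have "coef u {x} = 0" by (simp add: u_def a_def *(9) coef_var)
  then have du: "del x u = u" using del_linear[of u X x] uU UX by (auto simp: cst_simps)
  then have uY: "u \<in> homog ?Y 1" using del_homog[of u X 1 x] uU UX by auto
  have UHu: "U = ext H u" unfolding u_def ext_shift[OF lH aq] by (rule p(5))

  obtain g e where ge: "g \<in> homog ?Y k" "e \<in> homog ?Y (k - 1)" "c = g + ?x * e"
    using homog_split[OF c(1)] by blast
  \<comment> \<open>Because q = z + x, this means c = y + e q.\<close>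
  define y where "y = g - e * z"
  have y: "y \<in> homog ?Y k" unfolding y_def
    using ge homog_mult'[OF ge(2) *(8)] by (intro homog_diff) auto
  have "f * u = 0" using fU uU by blast
  then have "(g + ?x * e) * ((z + ?x) ^ 2 * (u * wL)) = 0"
    unfolding c(2) ge(3) *(9) by (simp add: mult_ac)
  from split_square[OF char ge(1,2) *(8) homog_mult[OF uY wL] _ this]
  have yzu: "y * z * u * wL = 0" by (simp add: y_def mult.assoc)

  define G where "G = ext L z"
  have zL: "z \<notin> L"
  proof
    assume "z \<in> L"
    then have "q - z \<in> H" using lin_closedD(4)[OF lH *(4)] LH by blast
    then have "?x \<in> H" by (simp add: *(9))
    then show False using spread_var[OF sprH _ lH] k by fastforce
  qed
  have flagG: "flag G m (z ^ 2 * wL)" unfolding G_def *(1) by (intro flag.intros * zL)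
  have GY: "G \<subseteq> homog ?Y 1" unfolding G_def *(10)[symmetric] using del_homog HX by blast
  \<comment> \<open>The degree k + 1 + 2l is 2m - 2 + (k + 1), and -2k lies below 3 - 2(k +
    1).\<close>
  have "\<exists>b\<in>homog ?Y (k + 1 - 2). y * u * wL = b * (z ^ 2 * wL)"
  proof (rule exact_below_B[OF IH finY GY flagG])
    show "spread G (- 1 - 2 * k + 1)"
      unfolding G_def *(10)[symmetric] by (rule spread_del[OF sprH lH HX fin])
    show "y * u * wL \<in> homog ?Y (k + 1 + 2 * int l)" by (intro homog_mult y uY wL)
    fix t assume "t \<in> G"
    then obtain s r where t: "t = s + cst r * z" "s \<in> L" by (auto simp: ext_def G_def)
    have "y * u * wL * t = y * u * (s * wL) + cst r * (y * z * u * wL)"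
      unfolding t by (simp add: algebra_simps)
    then show "y * u * wL * t = 0" using Lann[OF t(2)] yzu by simp
  qed (use cY k p(1) *(1) in auto)
  then obtain b where b: "b \<in> homog ?Y (k - 1)" "y * u * wL = b * (z ^ 2 * wL)" by auto

  have uz: "u ^ 3 = 0" "z ^ 3 = 0" "q ^ 3 = 0" using cube uY *(4,8) finY fin HX by blast+
  \<comment> \<open>For k \<ge> 1, G + u is U with x deleted, so 3 - 2k becomes 2 - 2(k - 1), as (A)
    in degree k - 1 asks. The top product of G + u kills b because y u^3 = 0.\<close>
  have "\<exists>b1\<in>homog ?Y (k - 2). \<exists>b2 r. ideal_part ?Y L (k - 1) r \<and> b = b1 * u + (b2 * z + r)"
  proof (cases "k = 0")
    case True
    then have "b = 0" using b(1) homog_neg by fastforce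
    then have "b = 0 * u + (0 * z + 0)" by simp
    then show ?thesis using homog_zero ideal_zero by blast
  next
    case False
    \<comment> \<open>A relation u = s + r z would give r x = s - u + r q in U, with r nonzero
      because u is not in H.\<close>
    have uG: "u \<notin> G"
    proof
      assume "u \<in> G"
      then obtain s r where s: "u = s + cst r * z" "s \<in> L" by (auto simp: ext_def G_def)
      have "r \<noteq> 0" using s uH LH by (auto simp: cst_simps)
      have "s \<in> U" "q \<in> U" using s(2) LH HU *(4) by auto
      then have "s - u + cst r * q \<in> U" using uU by (intro lin_closedD[OF lU])
      then have "cst r * ?x \<in> U" by (simp add: s *(9) algebra_simps)
      then have "cst (1 / r) * (cst r * ?x) \<in> U" by (rule lin_closedD[OF lU])
      then have "?x \<in> U"
        using \<open>r \<noteq> 0\<close> by (simp flip: mult.assoc cst_simps(2) add: cst_simps(6))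
      then show False using spread_var[OF spr _ lU] k False by fastforce
    qed
    have GU: "ext G u = del x ` U" unfolding UHu del_ext *(10) du G_def ..
    have flagGu: "flag (ext G u) n (u ^ 2 * (z ^ 2 * wL))" unfolding p(1) by (intro flag.intros flagG uG)
    have "ideal_part ?Y (ext G u) (k - 1) b"
    proof (rule exact_below_A[OF IH finY _ flagGu _ _ _ b(1)])
      show "ext G u \<subseteq> homog ?Y 1" unfolding GU using del_homog UX by blast
      show "spread (ext G u) (3 - 2 * k + 1)" unfolding GU by (rule spread_del[OF spr lU UX fin])
      have "b * (u ^ 2 * (z ^ 2 * wL)) = u ^ 2 * (y * u * wL)" unfolding b(2) by (simp add: mult_ac)
      also have "\<dots> = y * u ^ 3 * wL" by (simp add: mult_ac power2_eq_square power3_eq_cube)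
      finally show "b * (u ^ 2 * (z ^ 2 * wL)) = 0" using uz by simp
    qed (use cY in auto)
    then obtain b1 r1 where b1: "b1 \<in> homog ?Y (k - 1 - 1)" "ideal_part ?Y G (k - 1) r1" "b = b1 * u + r1"
      using ideal_part_ext by blast
    obtain b2 r where "ideal_part ?Y L (k - 1) r" "r1 = b2 * z + r"
      using ideal_part_ext b1(2) unfolding G_def by blast
    then show ?thesis using b1 by auto
  qed
  then obtain b1 b2 r where b1: "b1 \<in> homog ?Y (k - 2)" "ideal_part ?Y L (k - 1) r"
    "b = b1 * u + (b2 * z + r)" by blast
  \<comment> \<open>This cancels the part b1 u of b: multiplied by u and \<open>wL\<close>, what
    remains is b2 z^3 \<open>wL\<close> + z^2 r \<open>wL\<close>, and both terms vanish.\<close>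
  define y' where "y' = y - b1 * z ^ 2"
  have y': "y' \<in> homog ?Y k"
    unfolding y'_def using y homog_mult[OF b1(1) homog_square[OF *(8)]] by (intro homog_diff) auto
  have "r * wL = 0" using ideal_part_annihilated[OF b1(2)] Lann by blast
  have "y' * u * wL = y * u * wL - b1 * u * (z ^ 2 * wL)" by (simp add: y'_def algebra_simps)
  also have "\<dots> = b2 * z ^ 3 * wL + z ^ 2 * (r * wL)"
    unfolding b(2) b1(3) by (simp add: algebra_simps power2_eq_square power3_eq_cube)
  finally have y'u: "y' * u * wL = 0" using uz \<open>r * wL = 0\<close> by simp

  define V where "V = ext L u"
  have "u \<notin> L" using uH LH by blast
  then have flagV: "flag V m (u ^ 2 * wL)" unfolding V_def *(1) by (intro flag.intros *)
  have VY: "V \<subseteq> homog ?Y 1"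
  proof
    fix t assume "t \<in> V"
    then obtain s r where "t = s + cst r * u" "s \<in> L" by (auto simp: ext_def V_def)
    then show "t \<in> homog ?Y 1" using *(7) uY by (auto intro: homog_add homog_cst_mult)
  qed
  \<comment> \<open>V lies in U and avoids x, so it inherits the bound 3 - 2k, and X loses
    x.\<close>
  have "\<exists>b\<in>homog ?Y (k - 2). y' * wL = b * (u ^ 2 * wL)"
  proof (rule exact_below_B[OF IH finY VY flagV])
    have "V \<subseteq> U" unfolding V_def using LH HU uU by (intro ext_subset lU) auto
    then show "spread V (3 - 2 * k)" using spread_mono[OF spr] by blast
    show "y' * wL \<in> homog ?Y (k + 2 * int l)" by (intro homog_mult y' wL)
    fix t assume "t \<in> V"
    then obtain s r where t: "t = s + cst r * u" "s \<in> L" by (auto simp: ext_def V_def)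
    have "y' * wL * t = y' * (s * wL) + cst r * (y' * u * wL)"
      unfolding t by (simp add: algebra_simps)
    then show "y' * wL * t = 0" using Lann[OF t(2)] y'u by simp
  qed (use cY k p(1) *(1) in auto)
  then obtain b' where b': "b' \<in> homog ?Y (k - 2)" "y' * wL = b' * (u ^ 2 * wL)" by blast

  have "flag U n (u ^ 2 * (q ^ 2 * wL))"
    unfolding p(1) UHu using \<open>flag H m (q ^ 2 * wL)\<close> uH by (intro flag.intros)
  then obtain c2 where c2: "u ^ 2 * (q ^ 2 * wL) = cst c2 * w"
    using flag_unique[OF U] cube[OF fin] UX by blast
  have z: "z = q - ?x" by (simp add: *(9))
  \<comment> \<open>c = \<open>y'\<close> + b1 z^2 + e q, and q^2 kills the last two terms: q^3 = 0,
    and z^2 q^2 = (q - x)^2 q^2 involves only q^3 and x^2.\<close>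
  have "f = (y' * wL) * q ^ 2 + e * q ^ 3 * wL + b1 * wL * (z ^ 2 * q ^ 2)"
    unfolding c(2) ge(3) y'_def y_def *(9) by (simp add: algebra_simps power2_eq_square power3_eq_cube)
  also have "z ^ 2 * q ^ 2 = q ^ 3 * (q - 2 * ?x) + (?x * ?x) * q ^ 2"
    unfolding z by (simp add: algebra_simps power2_eq_square power3_eq_cube)
  also have "y' * wL * q ^ 2 = b' * (u ^ 2 * (q ^ 2 * wL))"
    unfolding b'(2) by (simp add: mult_ac)
  finally have "f = (cst c2 * b') * w"
    using uz unfolding c2 by (simp add: var_square mult_ac)
  moreover have "cst c2 * b' \<in> homog X (k - 2)"
    using b'(1) homog_mono[of b' ?Y "k - 2" X] by (intro homog_cst_mult) auto
  ultimately show "\<exists>b\<in>homog X (k - 2). f = b * w" by blast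
qed

section \<open>The simultaneous induction\<close>

lemma exactness:
  fixes U :: "'a::field sqf set"
  assumes inf: "infinite (UNIV :: 'a set)" and char: "CHAR('a) = 3"
    and "finite X" "U \<subseteq> homog X 1" "flag U n w"
  shows "spread U (2 - 2 * k) \<Longrightarrow> exact_A X U w k"
    and "k \<ge> 0 \<Longrightarrow> spread U (3 - 2 * k) \<Longrightarrow> exact_B X U n w k"
proof -
  have *: "exact_below TYPE('a) N" for N
  proof (induction N)
    case 0
    then show ?case by (simp add: exact_below_def)
  next
    case (Suc N)
    show ?case
      unfolding exact_below_def
    proof (intro allI impI)
      fix X and U :: "'a sqf set" and n w k
      assume fin: "finite X" and UX: "U \<subseteq> homog X 1" and U: "flag U n w" and "card X + n < Suc N"
      then have IH: "exact_below TYPE('a) (card X + n)"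
        using Suc.IH unfolding exact_below_def by (meson less_Suc_eq_le order_less_le_trans)
      show "(spread U (2 - 2 * k) \<longrightarrow> exact_A X U w k) \<and>
        (0 \<le> k \<longrightarrow> spread U (3 - 2 * k) \<longrightarrow> exact_B X U n w k)"
      proof (intro conjI impI)
        show "exact_A X U w k" if "spread U (2 - 2 * k)"
          using step_A[OF char fin UX U IH that] .
        assume k: "0 \<le> k" "spread U (3 - 2 * k)"
        consider "n = 0" | "n = 1" | "n \<ge> 2" by linarith
        then show "exact_B X U n w k"
        proof cases
          \<comment> \<open>For n = 0 the degree of f is k - 2 and w = 1, so f is its own
            cofactor.\<close>
          case 1
          then have "w = 1" using U by (simp add: flag_0_iff)
          then show ?thesis using 1 by (auto simp: exact_B_def)
        next
          case 2
          then show ?thesis using step_B_line[OF char fin UX _ _ k] U IH by simp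
        next
          case 3
          then show ?thesis using step_B_plane[OF inf char fin UX U IH k] by simp
        qed
      qed
    qed
  qed
  from *[of "Suc (card X + n)"] assms(3-5)
  show "spread U (2 - 2 * k) \<Longrightarrow> exact_A X U w k"
    and "k \<ge> 0 \<Longrightarrow> spread U (3 - 2 * k) \<Longrightarrow> exact_B X U n w k"
    unfolding exact_below_def by blast+
qed

section \<open>Subspaces of coefficient functions\<close>

lemma coef_linear: "coef (f + g) = coef f + coef g" "coef (cst c * f) = sc c (coef f)" "coef 0 = 0"
  by (auto simp: sc_def fun_eq_iff)

lemma sqf_of_coef [simp]: "sqf_of (coef f) = f"
  by (rule sqf_eqI) (simp add: coef_sqf_of)

lemma subspace_coef_image:
  assumes "lin_closed V" shows "FS.subspace (coef ` V)"
proof (rule FS.subspaceI)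
  note V = lin_closedD[OF assms]
  show "0 \<in> coef ` V" using V(1) coef_linear(3) by (metis imageI)
  show "x + y \<in> coef ` V" if "x \<in> coef ` V" "y \<in> coef ` V" for x y
    using that V(2) by (auto simp flip: coef_linear)
  show "sc c x \<in> coef ` V" if "x \<in> coef ` V" for c x
    using that V(3) by (auto simp flip: coef_linear)
qed

lemma Acomp_range: "f \<in> Acomp m j \<Longrightarrow> coef (sqf_of f) = f"
  by (auto simp: Acomp_def fun_eq_iff coef_sqf_of) (metis finite_lessThan finite_subset)

lemma Acomp_homog: "f \<in> Acomp m j \<Longrightarrow> sqf_of f \<in> homog {..<m} (int j)"
  by (auto simp: homog_def Acomp_def coef_sqf_of split: if_splits)

lemma homog_Aalg: "f \<in> homog {..<m} d \<Longrightarrow> coef f \<in> Aalg m"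
  unfolding homog_def Aalg_def by blast

lemma span_insert_coef:
  assumes "FS.span C = coef ` V"
  shows "FS.span (insert (coef u) C) = coef ` ext V u"
proof (intro subset_antisym subsetI)
  fix p assume "p \<in> FS.span (insert (coef u) C)"
  then obtain k v where v: "p - sc k (coef u) = coef v" "v \<in> V"
    unfolding FS.span_insert assms by blast
  then have "p = coef (v + cst k * u)" by (simp add: coef_linear flip: v(1))
  then show "p \<in> coef ` ext V u" using extI[OF v(2)] by blast
next
  fix p assume "p \<in> coef ` ext V u"
  then obtain k v where v: "p = coef (v + cst k * u)" "v \<in> V" by (auto simp: ext_def)
  then have "p - sc k (coef u) \<in> FS.span C" unfolding assms by (simp add: coef_linear)
  then show "p \<in> FS.span (insert (coef u) C)" unfolding FS.span_insert by blast
qed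

text \<open>Each basis vector lies outside the span of the earlier ones, which is what
  \<open>flag_Suc\<close> asks for.\<close>

lemma flag_of_basis:
  assumes "finite C" "FS.independent C" "C \<subseteq> range coef"
  shows "\<exists>V w. flag V (card C) w \<and> FS.span C = coef ` V"
  using assms
proof (induction C rule: finite_induct)
  case empty
  have "FS.span {} = coef ` {0}" by (simp add: coef_linear)
  then show ?case using flag_0 by (metis card.empty)
next
  case (insert b C)
  then have ind: "FS.independent C" "b \<notin> FS.span C"
    using FS.independent_insert[of b C] by auto
  obtain V w where V: "flag V (card C) w" "FS.span C = coef ` V"
    using insert ind by blast
  obtain u where u: "b = coef u" using insert.prems by blast
  have "u \<notin> V" using ind(2) V(2) u by blast
  then have "flag (ext V u) (card (insert b C)) (u ^ 2 * w)"
    using V(1) insert.hyps by (simp add: flag.intros)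
  then show ?case using span_insert_coef[OF V(2), of u] u by blast
qed

lemma basis_of_flag:
  assumes "flag V n w"
  shows "\<exists>C. finite C \<and> FS.independent C \<and> card C = n \<and> FS.span C = coef ` V"
  using assms
proof (induction rule: flag.induct)
  case flag_0
  show ?case by (rule exI[of _ "{}"]) (auto simp: FS.independent_empty fun_eq_iff)
next
  case (flag_Suc V n w u)
  from flag_Suc.IH obtain C where C: "finite C" "FS.independent C" "card C = n" "FS.span C = coef ` V"
    by (elim exE conjE)
  have "coef u \<notin> FS.span C" using C(4) flag_Suc.hyps(2) by (auto simp: coef_inject)
  moreover from this have "coef u \<notin> C" using FS.span_base by blast
  ultimately have "FS.independent (insert (coef u) C)" "card (insert (coef u) C) = Suc n"
    using C by (auto simp: FS.independent_insert)
  then show ?case using span_insert_coef[OF C(4)] C(1) by blast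
qed

text \<open>Comparing bases gives i \<le> n, and V is then a candidate in the minimum defining
  \<open>ms i\<close>.\<close>

lemma spread_of_ms:
  assumes "E \<subseteq> homog {..<m} 1" "flag E n w"
    and ms: "\<And>i. i \<in> {1..n} \<Longrightarrow> 4 * int i - c \<le> int (ms i (coef ` E))"
  shows "spread E c"
  unfolding spread_def
proof (intro allI impI)
  fix V i and w' :: "'a sqf" assume V: "flag V i w'" "V \<subseteq> E" "1 \<le> i"
  obtain B where B: "finite B" "card B = n" "FS.span B = coef ` E"
    using basis_of_flag[OF assms(2)] by blast
  obtain C where C: "FS.independent C" "card C = i" "FS.span C = coef ` V"
    using basis_of_flag[OF V(1)] by blast
  have "C \<subseteq> FS.span B" using FS.span_superset[of C] C(3) B(3) V(2) by blast
  then have "i \<in> {1..n}" using FS.independent_span_bound[OF B(1) C(1)] B(2) C(2) V(3) by simp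
  then have "4 * int i - c \<le> int (ms i (coef ` E))" by (rule ms)
  also have "ms i (coef ` E) \<le> card (supp_sp (coef ` V))"
    unfolding ms_def
  proof (rule Min_le)
    \<comment> \<open>Supports lie among m variables, so \<open>Min\<close> is taken over a finite
      set.\<close>
    have "card (supp_sp W) \<le> m" if "W \<subseteq> coef ` E" for W
    proof -
      have "supp_sp W \<subseteq> support E" using that by (auto simp: supp_sp_def supp_lf_def support_def)
      also have "\<dots> \<subseteq> {..<m}" by (rule support_subset[OF assms(1)])
      finally show ?thesis using card_mono[of "{..<m}"] by simp
    qed
    then have "{card (supp_sp W) |W. FS.subspace W \<and> W \<subseteq> coef ` E \<and> FS.dim W = i} \<subseteq> {..m}" by blast
    then show "finite {card (supp_sp W) |W. FS.subspace W \<and> W \<subseteq> coef ` E \<and> FS.dim W = i}"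
      by (rule finite_subset) simp
    have sub: "FS.subspace (coef ` V)" by (rule subspace_coef_image[OF flag_lin_closed[OF V(1)]])
    have "FS.span C = FS.span (coef ` V)" using C(3) FS.span_span by metis
    then have "FS.dim (coef ` V) = i" using FS.dim_eq_card C(1,2) by metis
    then show "card (supp_sp (coef ` V))
        \<in> {card (supp_sp W) |W. FS.subspace W \<and> W \<subseteq> coef ` E \<and> FS.dim W = i}"
      using sub V(2) by blast
  qed
  also have "supp_sp (coef ` V) = support V"
    by (auto simp: supp_sp_def supp_lf_def support_def)
  finally show "4 * int i - c \<le> int (card (support V))" by simp
qed

section \<open>Powers of U and generated ideals\<close>

lemma flag_top_product:
  "flag V n w \<Longrightarrow> \<exists>us. length us = 2 * n \<and> set us \<subseteq> coef ` V \<and> coef w = foldr amul us aone"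
proof (induction rule: flag.induct)
  case flag_0
  show ?case by (rule exI[of _ "[]"]) (simp add: coef_one)
next
  case (flag_Suc V n w u)
  then obtain us where us: "length us = 2 * n" "set us \<subseteq> coef ` V" "coef w = foldr amul us aone"
    by blast
  have "u \<in> ext V u" using in_ext flag_lin_closed flag_Suc.hyps(1) by blast
  moreover have "set us \<subseteq> coef ` ext V u" using us(2) subset_ext by blast
  moreover have "coef (u ^ 2 * w) = amul (coef u) (amul (coef u) (coef w))"
    by (simp add: power2_eq_square coef_mult amul_assoc)
  ultimately show ?case using us by (intro exI[of _ "coef u # coef u # us"]) simp
qed

lemma powsp_products: "powsp (coef ` V) r \<subseteq> coef ` {f. products V (int r) f}"
  unfolding powsp_def
proof (rule FS.span_minimal)
  have "foldr amul us aone \<in> coef ` {f. products V (int (length us)) f}"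
    if "set us \<subseteq> coef ` V" for us
    using that
  proof (induction us)
    case Nil
    have "products V 0 1" using products_cst[of V 1] by (simp add: cst_simps)
    then show ?case by (auto simp flip: coef_one)
  next
    case (Cons u us)
    then obtain f v where fv: "foldr amul us aone = coef f" "products V (int (length us)) f"
      "u = coef v" "v \<in> V" by auto
    then have "products V (int (length us) + 1) (v * f)" by (intro products_mult)
    then show ?case using fv by (auto simp: add.commute simp flip: coef_mult)
  qed
  then show "{foldr amul us aone |us. length us = r \<and> set us \<subseteq> coef ` V}
      \<subseteq> coef ` {f. products V (int r) f}" by blast
  have "lin_closed {f. products V (int r) f}"
    unfolding lin_closed_def by (auto intro: products.intros products_cst_mult)
  then show "FS.subspace (coef ` {f. products V (int r) f})" by (rule subspace_coef_image)
qed

lemma ideal_part_ideal_gen: "ideal_part {..<m} V d f \<Longrightarrow> coef f \<in> ideal_gen m (coef ` V)"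
  unfolding ideal_gen_def
proof (induction rule: ideal_part.induct)
  case ideal_zero
  then show ?case unfolding coef_linear(3) by (rule FS.span_zero)
next
  case (ideal_step a v f)
  then show ?case
    unfolding coef_linear(1) coef_mult
    by (intro FS.span_add[OF FS.span_base]) (auto dest: homog_Aalg)
qed

lemma amul_zero_right: "amul f 0 = 0"
  by (simp add: amul_def fun_eq_iff)

lemma ideal_gen_annihilated:
  assumes "f \<in> ideal_gen m W" "\<And>w. w \<in> W \<Longrightarrow> amul w p = 0"
  shows "amul f p = 0"
proof -
  have "FS.subspace {f. amul f p = 0}"
    by (rule FS.subspaceI) (auto simp: amul_add, auto simp: amul_def sc_def fun_eq_iff mult.assoc
        simp flip: sum_distrib_left)
  moreover have "{amul a w |a w. a \<in> Aalg m \<and> w \<in> W} \<subseteq> {f. amul f p = 0}"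
    using assms(2) by (auto simp: amul_assoc amul_zero_right)
  ultimately have "FS.span {amul a w |a w. a \<in> Aalg m \<and> w \<in> W} \<subseteq> {f. amul f p = 0}"
    by (intro FS.span_minimal)
  then show ?thesis using assms(1) unfolding ideal_gen_def by blast
qed

theorem theorem7:
  fixes U :: "(nat set \<Rightarrow> 'a::field) set" and m n k :: nat
  assumes "infinite (UNIV :: 'a set)" and "CHAR('a) = 3"
    and "FS.subspace U" and "U \<subseteq> Acomp m 1" and "FS.dim U = n" and "n \<ge> 1"
  shows "((\<forall>i\<in>{1..n}. ms i U \<ge> 4 * i - 2 + 2 * k) \<longrightarrow>
            {f \<in> Acomp m k. \<forall>w\<in>powsp U (2 * n). amul f w = 0} = Acomp m k \<inter> ideal_gen m U)
       \<and> ((\<forall>i\<in>{1..n}. ms i U \<ge> 4 * i - 3 + 2 * k) \<longrightarrow>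
            {f \<in> Acomp m (2 * n - 2 + k). \<forall>u\<in>U. amul f u = 0}
              = Acomp m (2 * n - 2 + k) \<inter> ideal_gen m (powsp U (2 * n)))"
proof -
  obtain C where C: "C \<subseteq> U" "FS.independent C" "U \<subseteq> FS.span C" "card C = n"
    using FS.basis_exists[of U] assms(5) by metis
  have "finite C" using C(4) assms(6) by (metis card.infinite not_one_le_zero)
  moreover have "C \<subseteq> range coef" using C(1) assms(4) Acomp_range by (metis rangeI subset_iff)
  ultimately obtain E w where E: "flag E n w" "FS.span C = coef ` E"
    using flag_of_basis C(2,4) by blast
  have "FS.span C = U" using C(1,3) FS.span_minimal[OF _ assms(3)] by blast
  then have UE: "U = coef ` E" using E(2) by simp
  have EX: "E \<subseteq> homog {..<m} 1"
  proof
    fix u assume "u \<in> E"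
    then have "coef u \<in> Acomp m 1" using UE assms(4) by blast
    from Acomp_homog[OF this] show "u \<in> homog {..<m} 1" by simp
  qed
  have cube: "u ^ 3 = 0" if "u \<in> E" for u
    using linear_cube[OF assms(2) _ subsetD[OF EX that]] by simp
  note exact = exactness[OF assms(1,2) finite_lessThan EX E(1)]

  have top: "coef w \<in> powsp U (2 * n)"
    using flag_top_product[OF E(1)] unfolding UE powsp_def by (intro FS.span_base) blast
  \<comment> \<open>U kills U^{2n}, whose elements are multiples of w. Both easy inclusions come
    from this.\<close>
  have ann: "amul u p = 0" if up: "u \<in> U" "p \<in> powsp U (2 * n)" for u p
  proof -
    obtain v where v: "u = coef v" "v \<in> E" using up(1) UE by blast
    have "p \<in> coef ` {f. products E (int (2 * n)) f}" using up(2) powsp_products unfolding UE by blast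
    then obtain f where f: "p = coef f" "products E (2 * int n) f" by auto
    obtain c where "f = cst c * w" using flag_products[OF E(1) cube f(2)] by blast
    then have "v * f = 0" using flag_annihilated[OF E(1) cube v(2)]
      by (metis mult.left_commute mult_zero_right)
    then show ?thesis unfolding v f(1) coef_mult[symmetric] by (simp only: coef_linear(3))
  qed
  show ?thesis
  proof (intro conjI impI subset_antisym subsetI)
    fix f assume ms: "\<forall>i\<in>{1..n}. ms i U \<ge> 4 * i - 2 + 2 * k"
      and "f \<in> {f \<in> Acomp m k. \<forall>w\<in>powsp U (2 * n). amul f w = 0}"
    then have f: "f \<in> Acomp m k" "amul f (coef w) = 0" using top by auto
    have "spread E (2 - 2 * int k)"
    proof (rule spread_of_ms[OF EX E(1)])
      fix i assume i: "i \<in> {1..n}"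
      then have "4 * i - 2 + 2 * k \<le> ms i (coef ` E)" using ms UE by blast
      \<comment> \<open>The natural subtraction 4i - 2 is exact because i \<ge> 1.\<close>
      then show "4 * int i - (2 - 2 * int k) \<le> int (ms i (coef ` E))" using i by simp
    qed
    then have "exact_A {..<m} E w k" by (rule exact(1))
    moreover have "sqf_of f * w = 0"
      using f by (intro sqf_eqI) (simp add: coef_mult Acomp_range)
    ultimately have "ideal_part {..<m} E k (sqf_of f)"
      using Acomp_homog[OF f(1)] unfolding exact_A_def by blast
    then show "f \<in> Acomp m k \<inter> ideal_gen m U"
      using ideal_part_ideal_gen f(1) Acomp_range UE by fastforce
  next
    fix f assume "f \<in> Acomp m k \<inter> ideal_gen m U"
    then show "f \<in> {f \<in> Acomp m k. \<forall>w\<in>powsp U (2 * n). amul f w = 0}"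
      using ideal_gen_annihilated ann by blast
  next
    fix f assume ms: "\<forall>i\<in>{1..n}. ms i U \<ge> 4 * i - 3 + 2 * k"
      and "f \<in> {f \<in> Acomp m (2 * n - 2 + k). \<forall>u\<in>U. amul f u = 0}"
    then have f: "f \<in> Acomp m (2 * n - 2 + k)" "\<forall>u\<in>U. amul f u = 0" by auto
    have "spread E (3 - 2 * int k)"
    proof (rule spread_of_ms[OF EX E(1)])
      fix i assume i: "i \<in> {1..n}"
      then have "4 * i - 3 + 2 * k \<le> ms i (coef ` E)" using ms UE by blast
      then show "4 * int i - (3 - 2 * int k) \<le> int (ms i (coef ` E))" using i by simp
    qed
    then have "exact_B {..<m} E n w k" by (intro exact(2)) simp_all
    \<comment> \<open>Here n \<ge> 1 makes 2n - 2 exact.\<close>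
    moreover have "int (2 * n - 2 + k) = 2 * int n - 2 + int k" using assms(6) by simp
    then have "sqf_of f \<in> homog {..<m} (2 * int n - 2 + int k)" using Acomp_homog[OF f(1)] by (simp only:)
    moreover have "sqf_of f * u = 0" if "u \<in> E" for u
      using f that UE by (intro sqf_eqI) (simp add: coef_mult Acomp_range)
    ultimately obtain b where b: "b \<in> homog {..<m} (int k - 2)" "sqf_of f = b * w"
      unfolding exact_B_def by blast
    have "f = amul (coef b) (coef w)"
      using arg_cong[OF b(2), of coef] Acomp_range[OF f(1)] by (simp add: coef_mult)
    then have "f \<in> ideal_gen m (powsp U (2 * n))"
      unfolding ideal_gen_def using homog_Aalg[OF b(1)] top by (intro FS.span_base) blast
    then show "f \<in> Acomp m (2 * n - 2 + k) \<inter> ideal_gen m (powsp U (2 * n))" using f(1) by blast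
  next
    fix f assume f: "f \<in> Acomp m (2 * n - 2 + k) \<inter> ideal_gen m (powsp U (2 * n))"
    have "amul f u = 0" if "u \<in> U" for u
      using f ann[OF that] amul_commute by (metis IntD2 ideal_gen_annihilated)
    then show "f \<in> {f \<in> Acomp m (2 * n - 2 + k). \<forall>u\<in>U. amul f u = 0}" using f by blast
  qed
qed

end
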